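(* Let $\Gamma$ be a cancelation monoid, let $A=\bigoplus_{\gamma\in\Gamma}A_\gamma$ be a $\Gamma$-graded local ring, and let $P$ be a finitely generated gr-projective $A$-module. Then $P$ is a free $A$-module. Indeed, any minimal homogeneous generating set $\Omega=\{\xi_1,\ldots,\xi_s\}$ of $P$ forms a free $A$-basis of $P$.
   Context: Rings are associative with identity $1$, not necessarily commutative; modules are unitary left modules. A cancelation monoid is a (not necessarily commutative) monoid with neutral element $e$ satisfying the left and right cancelation laws. A $\Gamma$-graded ring is a ring $A=\bigoplus_{\gamma\in\Gamma}A_\gamma$ (additive subgroups) with $A_{\gamma_1}A_{\gamma_2}\subseteq A_{\gamma_1\gamma_2}$; a $\Gamma$-graded $A$-module is a module $M=\bigoplus_{\gamma\in\Gamma}M_\gamma$ (additive subgroups) with $A_{\gamma_1}M_{\gamma_2}\subseteq M_{\gamma_1\gamma_2}$. A homogeneous element of degree $\gamma$ is a nonzero element of $M_\gamma$. A $\Gamma$-graded local ring is a $\Gamma$-graded ring $A$ whose degree-$e$ part $A_e$ is a local ring (it has a unique maximal left ideal, which is also its unique maximal right and two-sided ideal). A gr-projective $A$-module is a $\Gamma$-graded $A$-module $P$ that is projective as an ungraded $A$-module; equivalently, $P$ is a graded direct summand of a $\Gamma$-graded $A$-module having a free $A$-basis of homogeneous elements. A minimal homogeneous generating set is a generating set consisting of homogeneous elements such that no proper subset generates the module. *)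

theory Defs
  imports "HOL-Algebra.Divisibility" "HOL-Algebra.Ideal" "HOL-Algebra.Module"
begin

section \<open>Left modules over a not necessarily commutative ring\<close>

text \<open>The library locale \<^locale>\<open>module\<close> has the same axioms but insists on a commutative ring of
  scalars. As there, the ring multiplication and unit in the module record are not used.\<close>

locale left_module = R?: ring R + M?: abelian_group M
  for R :: "('a, 'b) ring_scheme" (structure) and M :: "('a, 'm, 'c) module_scheme" (structure) +
  assumes smult_closed [simp, intro]:
      "\<lbrakk>a \<in> carrier R; x \<in> carrier M\<rbrakk> \<Longrightarrow> a \<odot>\<^bsub>M\<^esub> x \<in> carrier M"
    and smult_l_distr:
      "\<lbrakk>a \<in> carrier R; b \<in> carrier R; x \<in> carrier M\<rbrakk> \<Longrightarrow>
        (a \<oplus> b) \<odot>\<^bsub>M\<^esub> x = a \<odot>\<^bsub>M\<^esub> x \<oplus>\<^bsub>M\<^esub> b \<odot>\<^bsub>M\<^esub> x"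
    and smult_r_distr:
      "\<lbrakk>a \<in> carrier R; x \<in> carrier M; y \<in> carrier M\<rbrakk> \<Longrightarrow>
        a \<odot>\<^bsub>M\<^esub> (x \<oplus>\<^bsub>M\<^esub> y) = a \<odot>\<^bsub>M\<^esub> x \<oplus>\<^bsub>M\<^esub> a \<odot>\<^bsub>M\<^esub> y"
    and smult_assoc1:
      "\<lbrakk>a \<in> carrier R; b \<in> carrier R; x \<in> carrier M\<rbrakk> \<Longrightarrow>
        (a \<otimes> b) \<odot>\<^bsub>M\<^esub> x = a \<odot>\<^bsub>M\<^esub> (b \<odot>\<^bsub>M\<^esub> x)"
    and smult_one [simp]:
      "x \<in> carrier M \<Longrightarrow> \<one> \<odot>\<^bsub>M\<^esub> x = x"

definition left_module_hom ::
  "('a, 'b) ring_scheme \<Rightarrow> ('a, 'm, 'c) module_scheme \<Rightarrow> ('a, 'n, 'd) module_scheme \<Rightarrow> ('m \<Rightarrow> 'n) set"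
  where "left_module_hom R M N =
    {h \<in> carrier M \<rightarrow> carrier N.
      (\<forall>x\<in>carrier M. \<forall>y\<in>carrier M. h (x \<oplus>\<^bsub>M\<^esub> y) = h x \<oplus>\<^bsub>N\<^esub> h y) \<and>
      (\<forall>a\<in>carrier R. \<forall>x\<in>carrier M. h (a \<odot>\<^bsub>M\<^esub> x) = a \<odot>\<^bsub>N\<^esub> h x)}"

definition generates :: "('a, 'b) ring_scheme \<Rightarrow> ('a, 'm, 'c) module_scheme \<Rightarrow> 'm set \<Rightarrow> bool"
  where "generates R M T \<longleftrightarrow> T \<subseteq> carrier M \<and> \<Inter>{H. submodule H R M \<and> T \<subseteq> H} = carrier M"

definition finitely_generated :: "('a, 'b) ring_scheme \<Rightarrow> ('a, 'm, 'c) module_scheme \<Rightarrow> bool"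
  where "finitely_generated R M \<longleftrightarrow> (\<exists>T. finite T \<and> generates R M T)"

definition linearly_independent ::
  "('a, 'b) ring_scheme \<Rightarrow> ('a, 'm, 'c) module_scheme \<Rightarrow> 'm set \<Rightarrow> bool"
  where "linearly_independent R M B \<longleftrightarrow> B \<subseteq> carrier M \<and>
    (\<forall>F c. finite F \<and> F \<subseteq> B \<and> c \<in> F \<rightarrow> carrier R \<and> (\<Oplus>\<^bsub>M\<^esub>x\<in>F. c x \<odot>\<^bsub>M\<^esub> x) = \<zero>\<^bsub>M\<^esub>
      \<longrightarrow> (\<forall>x\<in>F. c x = \<zero>\<^bsub>R\<^esub>))"

definition free_basis :: "('a, 'b) ring_scheme \<Rightarrow> ('a, 'm, 'c) module_scheme \<Rightarrow> 'm set \<Rightarrow> bool"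
  where "free_basis R M B \<longleftrightarrow> generates R M B \<and> linearly_independent R M B"

definition free_module :: "('a, 'b) ring_scheme \<Rightarrow> ('a, 'm, 'c) module_scheme \<Rightarrow> bool"
  where "free_module R M \<longleftrightarrow> left_module R M \<and> (\<exists>B. free_basis R M B)"

text \<open>Projectivity is the lifting property along surjections. A definition cannot quantify over
  types, so the test modules \<open>M\<close> and \<open>N\<close> are taken with elements in \<^typ>\<open>'p \<Rightarrow> 'a\<close> and \<^typ>\<open>'p\<close>.
  These types have room for the free module on the set of elements of \<open>P\<close> and for \<open>P\<close> itself,
  which makes the restriction immaterial: the lifting property for modules over arbitrary types
  is the lemma \<open>projective_module_lift\<close> below.\<close>

definition projective_module :: "('a, 'b) ring_scheme \<Rightarrow> ('a, 'p, 'c) module_scheme \<Rightarrow> bool"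
  where "projective_module R P \<longleftrightarrow> left_module R P \<and>
    (\<forall>(M :: ('a, 'p \<Rightarrow> 'a) module) (N :: ('a, 'p) module).
      \<forall>g \<in> left_module_hom R M N. \<forall>f \<in> left_module_hom R P N.
        left_module R M \<and> left_module R N \<and> g ` carrier M = carrier N \<longrightarrow>
        (\<exists>h \<in> left_module_hom R P M. \<forall>x\<in>carrier P. g (h x) = f x))"

context left_module
begin

lemma smult_l_null [simp]:
  assumes "x \<in> carrier M" shows "\<zero> \<odot>\<^bsub>M\<^esub> x = \<zero>\<^bsub>M\<^esub>"
proof -
  have "\<zero> \<odot>\<^bsub>M\<^esub> x = \<zero> \<odot>\<^bsub>M\<^esub> x \<oplus>\<^bsub>M\<^esub> \<zero> \<odot>\<^bsub>M\<^esub> x"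
    using smult_l_distr[of \<zero> \<zero> x] assms by simp
  then show ?thesis using assms by (metis M.add.r_cancel_one' R.zero_closed smult_closed)
qed

lemma smult_r_null [simp]:
  assumes "a \<in> carrier R" shows "a \<odot>\<^bsub>M\<^esub> \<zero>\<^bsub>M\<^esub> = \<zero>\<^bsub>M\<^esub>"
proof -
  have "a \<odot>\<^bsub>M\<^esub> \<zero>\<^bsub>M\<^esub> = a \<odot>\<^bsub>M\<^esub> \<zero>\<^bsub>M\<^esub> \<oplus>\<^bsub>M\<^esub> a \<odot>\<^bsub>M\<^esub> \<zero>\<^bsub>M\<^esub>"
    using smult_r_distr[of a "\<zero>\<^bsub>M\<^esub>" "\<zero>\<^bsub>M\<^esub>"] assms by simp
  then show ?thesis using assms by (metis M.add.r_cancel_one' M.zero_closed smult_closed)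
qed

lemma finsum_smult_ldistr:
  "\<lbrakk>finite A; a \<in> carrier R; f \<in> A \<rightarrow> carrier M\<rbrakk> \<Longrightarrow>
     a \<odot>\<^bsub>M\<^esub> (\<Oplus>\<^bsub>M\<^esub>i\<in>A. f i) = (\<Oplus>\<^bsub>M\<^esub>i\<in>A. a \<odot>\<^bsub>M\<^esub> f i)"
  by (induct set: finite) (simp_all add: Pi_def smult_r_distr)

end

text \<open>Coordinate-wise free module on a set, and the linear extension of a map on its basis.\<close>

definition free_on :: "('a, 'b) ring_scheme \<Rightarrow> 'i set \<Rightarrow> ('a, 'i \<Rightarrow> 'a) module"
  where "free_on R I =
    \<lparr>carrier = {c. (\<forall>i. c i \<in> carrier R) \<and> finite {i. c i \<noteq> \<zero>\<^bsub>R\<^esub>} \<and> {i. c i \<noteq> \<zero>\<^bsub>R\<^esub>} \<subseteq> I},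
     mult = (\<lambda>c d i. \<zero>\<^bsub>R\<^esub>), one = (\<lambda>i. \<zero>\<^bsub>R\<^esub>),
     zero = (\<lambda>i. \<zero>\<^bsub>R\<^esub>), add = (\<lambda>c d i. c i \<oplus>\<^bsub>R\<^esub> d i),
     smult = (\<lambda>a c i. a \<otimes>\<^bsub>R\<^esub> c i)\<rparr>"

definition lin_ext ::
  "('a, 'b) ring_scheme \<Rightarrow> ('a, 'm, 'c) module_scheme \<Rightarrow> ('i \<Rightarrow> 'm) \<Rightarrow> ('i \<Rightarrow> 'a) \<Rightarrow> 'm"
  where "lin_ext R M t c = (\<Oplus>\<^bsub>M\<^esub>i\<in>{i. c i \<noteq> \<zero>\<^bsub>R\<^esub>}. c i \<odot>\<^bsub>M\<^esub> t i)"

lemma (in ring) free_on_left_module: "left_module R (free_on R I)"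
proof (intro left_module.intro left_module_axioms.intro)
  show "ring R" by (rule ring_axioms)
  show "abelian_group (free_on R I)"
  proof (rule abelian_groupI)
    fix c d assume "c \<in> carrier (free_on R I)" "d \<in> carrier (free_on R I)"
    moreover have "{i. c i \<oplus> d i \<noteq> \<zero>} \<subseteq> {i. c i \<noteq> \<zero>} \<union> {i. d i \<noteq> \<zero>}" by auto
    ultimately show "c \<oplus>\<^bsub>free_on R I\<^esub> d \<in> carrier (free_on R I)"
      unfolding free_on_def
      by simp (meson finite_UnI finite_subset le_sup_iff order_trans)
  next
    fix c assume c: "c \<in> carrier (free_on R I)"
    then have "(\<lambda>i. \<ominus> c i) \<in> carrier (free_on R I)"
      by (simp add: free_on_def)
    moreover have "(\<lambda>i. \<ominus> c i) \<oplus>\<^bsub>free_on R I\<^esub> c = \<zero>\<^bsub>free_on R I\<^esub>"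
      using c by (simp add: free_on_def l_neg)
    ultimately show "\<exists>d\<in>carrier (free_on R I). d \<oplus>\<^bsub>free_on R I\<^esub> c = \<zero>\<^bsub>free_on R I\<^esub>" by blast
  qed (auto simp: free_on_def a_ac)
next
  fix a c assume a: "a \<in> carrier R" and c: "c \<in> carrier (free_on R I)"
  have "{i. a \<otimes> c i \<noteq> \<zero>} \<subseteq> {i. c i \<noteq> \<zero>}" using a by auto
  with a c show "a \<odot>\<^bsub>free_on R I\<^esub> c \<in> carrier (free_on R I)"
    unfolding free_on_def by simp (meson finite_subset order_trans)
qed (auto simp: free_on_def l_distr r_distr m_assoc)

lemma (in left_module) lin_ext_superset:
  assumes c: "c \<in> carrier (free_on R I)" and t: "t \<in> I \<rightarrow> carrier M"
    and F: "finite F" "{i. c i \<noteq> \<zero>} \<subseteq> F" "F \<subseteq> I"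
  shows "lin_ext R M t c = (\<Oplus>\<^bsub>M\<^esub>i\<in>F. c i \<odot>\<^bsub>M\<^esub> t i)"
  unfolding lin_ext_def
proof (rule M.add.finprod_mono_neutral_cong_left)
  show "\<And>i. i \<in> F - {i. c i \<noteq> \<zero>} \<Longrightarrow> c i \<odot>\<^bsub>M\<^esub> t i = \<zero>\<^bsub>M\<^esub>"
    using t F by (auto intro!: smult_l_null)
  show "(\<lambda>i. c i \<odot>\<^bsub>M\<^esub> t i) \<in> F \<rightarrow> carrier M"
    using c t F by (auto simp: free_on_def intro!: smult_closed)
qed (use F in auto)

lemma (in left_module) lin_ext_hom:
  assumes t: "t \<in> I \<rightarrow> carrier M"
  shows "lin_ext R M t \<in> left_module_hom R (free_on R I) M"
proof -
  interpret F: left_module R "free_on R I" by (rule R.free_on_left_module)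
  have cl: "lin_ext R M t c \<in> carrier M" if c: "c \<in> carrier (free_on R I)" for c
    unfolding lin_ext_def using c t by (intro M.finsum_closed) (auto simp: free_on_def)
  have ad: "lin_ext R M t (c \<oplus>\<^bsub>free_on R I\<^esub> d) = lin_ext R M t c \<oplus>\<^bsub>M\<^esub> lin_ext R M t d"
    if c: "c \<in> carrier (free_on R I)" and d: "d \<in> carrier (free_on R I)" for c d
  proof -
    let ?F = "{i. c i \<noteq> \<zero>} \<union> {i. d i \<noteq> \<zero>}"
    have F: "finite ?F" "?F \<subseteq> I" using c d by (auto simp: free_on_def)
    have cd: "c i \<in> carrier R" "d i \<in> carrier R" for i using c d by (auto simp: free_on_def)
    have ti: "t i \<in> carrier M" if "i \<in> ?F" for i using t F that by blast
    have "lin_ext R M t (c \<oplus>\<^bsub>free_on R I\<^esub> d) = (\<Oplus>\<^bsub>M\<^esub>i\<in>?F. (c i \<oplus> d i) \<odot>\<^bsub>M\<^esub> t i)"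
    proof -
      have "{i. c i \<oplus> d i \<noteq> \<zero>} \<subseteq> ?F" by auto
      then show ?thesis
        using lin_ext_superset[OF F.add.m_closed[OF c d] t F(1) _ F(2)]
        by (simp add: free_on_def)
    qed
    also have "\<dots> = (\<Oplus>\<^bsub>M\<^esub>i\<in>?F. c i \<odot>\<^bsub>M\<^esub> t i \<oplus>\<^bsub>M\<^esub> d i \<odot>\<^bsub>M\<^esub> t i)"
      using cd ti by (intro M.finsum_cong') (auto simp: smult_l_distr)
    also have "\<dots> = (\<Oplus>\<^bsub>M\<^esub>i\<in>?F. c i \<odot>\<^bsub>M\<^esub> t i) \<oplus>\<^bsub>M\<^esub> (\<Oplus>\<^bsub>M\<^esub>i\<in>?F. d i \<odot>\<^bsub>M\<^esub> t i)"
      using cd ti by (intro M.finsum_addf) auto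
    also have "\<dots> = lin_ext R M t c \<oplus>\<^bsub>M\<^esub> lin_ext R M t d"
      using lin_ext_superset[OF c t F(1) _ F(2)] lin_ext_superset[OF d t F(1) _ F(2)] by simp
    finally show ?thesis .
  qed
  have sm: "lin_ext R M t (a \<odot>\<^bsub>free_on R I\<^esub> c) = a \<odot>\<^bsub>M\<^esub> lin_ext R M t c"
    if a: "a \<in> carrier R" and c: "c \<in> carrier (free_on R I)" for a c
  proof -
    let ?F = "{i. c i \<noteq> \<zero>}"
    have F: "finite ?F" "?F \<subseteq> I" using c by (auto simp: free_on_def)
    have ci: "c i \<in> carrier R" for i using c by (auto simp: free_on_def)
    have ti: "t i \<in> carrier M" if "i \<in> ?F" for i using t F that by blast
    have "lin_ext R M t (a \<odot>\<^bsub>free_on R I\<^esub> c) = (\<Oplus>\<^bsub>M\<^esub>i\<in>?F. (a \<otimes> c i) \<odot>\<^bsub>M\<^esub> t i)"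
    proof -
      have "{i. a \<otimes> c i \<noteq> \<zero>} \<subseteq> ?F" using a by auto
      then show ?thesis
        using lin_ext_superset[OF F.smult_closed[OF a c] t F(1) _ F(2)]
        by (simp add: free_on_def)
    qed
    also have "\<dots> = (\<Oplus>\<^bsub>M\<^esub>i\<in>?F. a \<odot>\<^bsub>M\<^esub> (c i \<odot>\<^bsub>M\<^esub> t i))"
      using a ci ti by (intro M.finsum_cong') (auto simp: smult_assoc1)
    also have "\<dots> = a \<odot>\<^bsub>M\<^esub> lin_ext R M t c"
      unfolding lin_ext_def using a ci ti F(1) by (intro finsum_smult_ldistr[symmetric]) auto
    finally show ?thesis .
  qed
  show ?thesis unfolding left_module_hom_def using cl ad sm by auto
qed

lemma projective_module_lift:
  fixes R :: "('a, 'b) ring_scheme" and P :: "('a, 'p, 'c) module_scheme"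
    and M :: "('a, 'm, 'd) module_scheme" and N :: "('a, 'n, 'e) module_scheme"
  assumes P: "projective_module R P" and M: "left_module R M" and N: "left_module R N"
    and g: "g \<in> left_module_hom R M N" and surj: "g ` carrier M = carrier N"
    and f: "f \<in> left_module_hom R P N"
  shows "\<exists>h \<in> left_module_hom R P M. \<forall>x\<in>carrier P. g (h x) = f x"
proof -
  interpret P: left_module R P using P by (simp add: projective_module_def)
  interpret M: left_module R M by (rule M)
  interpret N: left_module R N by (rule N)
  let ?I = "carrier P"
  define F where "F = free_on R ?I"
  interpret F: left_module R F unfolding F_def by (rule P.R.free_on_left_module)
  define P0 :: "('a, 'p) module" where
    "P0 = \<lparr>carrier = carrier P, mult = mult P, one = one P, zero = zero P, add = add P,
           smult = smult P\<rparr>"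
  have P0: "left_module R P0"
  proof (intro left_module.intro left_module_axioms.intro)
    show "ring R" by (rule P.R.ring_axioms)
    show "abelian_group P0"
    proof (rule abelian_groupI)
      fix x assume "x \<in> carrier P0"
      then show "\<exists>y\<in>carrier P0. y \<oplus>\<^bsub>P0\<^esub> x = \<zero>\<^bsub>P0\<^esub>"
        using P.M.l_neg P.M.a_inv_closed unfolding P0_def by auto
    qed (simp_all add: P0_def P.M.a_ac)
  qed (simp_all add: P0_def P.smult_l_distr P.smult_r_distr P.smult_assoc1)
  interpret P0: left_module R P0 by (rule P0)
  define \<pi> where "\<pi> = lin_ext R P0 id"
  have \<pi>: "\<pi> \<in> left_module_hom R F P0"
    unfolding \<pi>_def F_def by (rule P0.lin_ext_hom) (simp add: P0_def)
  have "x \<in> \<pi> ` carrier F" if x: "x \<in> carrier P0" for x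
  proof -
    define c where "c = (\<lambda>i. if i = x then \<one>\<^bsub>R\<^esub> else \<zero>\<^bsub>R\<^esub>)"
    have sub: "{i. c i \<noteq> \<zero>\<^bsub>R\<^esub>} \<subseteq> {x}" by (auto simp: c_def)
    have c: "c \<in> carrier F"
      using sub x unfolding F_def free_on_def P0_def
      by (auto simp: c_def)
    have "\<pi> c = (\<Oplus>\<^bsub>P0\<^esub>i\<in>{x}. c i \<odot>\<^bsub>P0\<^esub> id i)"
      unfolding \<pi>_def using c sub x
      by (intro P0.lin_ext_superset[of c ?I]) (auto simp: F_def P0_def)
    also have "\<dots> = x" using x by (simp add: c_def)
    finally show ?thesis using c by force
  qed
  then have \<pi>_surj: "\<pi> ` carrier F = carrier P0"
    using \<pi> by (auto simp: left_module_hom_def)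
  have id: "id \<in> left_module_hom R P P0"
    by (auto simp: left_module_hom_def P0_def)
  obtain s where s: "s \<in> left_module_hom R P F" "\<forall>x\<in>carrier P. \<pi> (s x) = id x"
    using P \<pi> id \<pi>_surj F.left_module_axioms P0
    unfolding projective_module_def by blast
  have "\<forall>x\<in>carrier P. \<exists>y\<in>carrier M. g y = f x"
  proof
    fix x assume "x \<in> carrier P"
    then have "f x \<in> g ` carrier M"
      using f surj unfolding left_module_hom_def by blast
    then show "\<exists>y\<in>carrier M. g y = f x" by (metis imageE)
  qed
  then obtain t where t: "\<forall>x\<in>carrier P. t x \<in> carrier M \<and> g (t x) = f x" by metis
  define k where "k = lin_ext R M t"
  have k: "k \<in> left_module_hom R F M"
    unfolding k_def F_def by (rule M.lin_ext_hom) (use t in blast)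
  have sums: "\<phi> (\<Oplus>\<^bsub>L\<^esub>i\<in>A. u i) = (\<Oplus>\<^bsub>N\<^esub>i\<in>A. \<phi> (u i))"
    if L: "left_module R L" and \<phi>: "\<phi> \<in> left_module_hom R L N"
      and A: "finite A" and u: "u \<in> A \<rightarrow> carrier L"
    for L :: "('a, 'l, 'x) module_scheme" and \<phi> and A :: "'i set" and u
  proof -
    interpret L: left_module R L by (rule L)
    have "\<phi> \<zero>\<^bsub>L\<^esub> = \<phi> (\<zero>\<^bsub>R\<^esub> \<odot>\<^bsub>L\<^esub> \<zero>\<^bsub>L\<^esub>)" by simp
    also have "\<dots> = \<zero>\<^bsub>R\<^esub> \<odot>\<^bsub>N\<^esub> \<phi> \<zero>\<^bsub>L\<^esub>" 
      using \<phi> L.M.zero_closed P.R.zero_closed unfolding left_module_hom_def by blast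
    also have "\<dots> = \<zero>\<^bsub>N\<^esub>"
      using \<phi> L.M.zero_closed unfolding left_module_hom_def by (intro N.smult_l_null) blast
    finally have z: "\<phi> \<zero>\<^bsub>L\<^esub> = \<zero>\<^bsub>N\<^esub>" .
    show ?thesis using A u
      by (induct set: finite) (use \<phi> z in \<open>auto simp: left_module_hom_def Pi_def\<close>)
  qed
  have gk: "g (k c) = f (\<pi> c)" if c: "c \<in> carrier F" for c
  proof -
    let ?A = "{i. c i \<noteq> \<zero>\<^bsub>R\<^esub>}"
    have A: "finite ?A" "?A \<subseteq> carrier P" and ci: "\<And>i. c i \<in> carrier R"
      using c by (auto simp: F_def free_on_def)
    have "g (k c) = (\<Oplus>\<^bsub>N\<^esub>i\<in>?A. g (c i \<odot>\<^bsub>M\<^esub> t i))"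
      unfolding k_def lin_ext_def
      using A ci t by (intro sums[OF M g]) auto
    also have "\<dots> = (\<Oplus>\<^bsub>N\<^esub>i\<in>?A. f (c i \<odot>\<^bsub>P0\<^esub> i))"
    proof (rule N.M.finsum_cong')
      fix i assume "i \<in> ?A"
      with A have i: "i \<in> carrier P" by blast
      show "g (c i \<odot>\<^bsub>M\<^esub> t i) = f (c i \<odot>\<^bsub>P0\<^esub> i)"
        using g f ci t i unfolding left_module_hom_def P0_def by auto
    next
      show "(\<lambda>i. f (c i \<odot>\<^bsub>P0\<^esub> i)) \<in> ?A \<rightarrow> carrier N"
        using f A ci unfolding left_module_hom_def P0_def by auto
    qed simp
    also have "\<dots> = f (\<Oplus>\<^bsub>P0\<^esub>i\<in>?A. c i \<odot>\<^bsub>P0\<^esub> i)"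
    proof (rule sums[OF P0, symmetric])
      show "f \<in> left_module_hom R P0 N" using f by (auto simp: left_module_hom_def P0_def)
      show "(\<lambda>i. c i \<odot>\<^bsub>P0\<^esub> i) \<in> ?A \<rightarrow> carrier P0" using A ci by (auto simp: P0_def)
    qed (use A in auto)
    finally show ?thesis by (simp add: \<pi>_def lin_ext_def)
  qed
  have "k \<circ> s \<in> left_module_hom R P M"
    using k s(1) by (auto simp: left_module_hom_def Pi_def)
  moreover have "\<forall>x\<in>carrier P. g ((k \<circ> s) x) = f x"
    using gk s by (auto simp: left_module_hom_def Pi_def)
  ultimately show ?thesis by blast
qed


section \<open>Local rings\<close>

locale left_ideal = additive_subgroup I R + ring R for I and R (structure) +
  assumes I_l_closed: "\<lbrakk>a \<in> I; x \<in> carrier R\<rbrakk> \<Longrightarrow> x \<otimes> a \<in> I"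

locale maximal_left_ideal = left_ideal +
  assumes I_notcarr: "carrier R \<noteq> I"
    and I_maximal: "\<lbrakk>left_ideal J R; I \<subseteq> J; J \<subseteq> carrier R\<rbrakk> \<Longrightarrow> J = I \<or> J = carrier R"

locale local_ring = ring R for R (structure) +
  assumes unique_maximal_left_ideal: "\<exists>!I. maximal_left_ideal I R"


section \<open>Graded rings and modules\<close>

text \<open>Internal direct sum of additive subgroups: every element is the sum of a unique finitely
  supported family. Families are extensional on the index set, so that uniqueness is literal;
  the sum runs over the support because \<^const>\<open>finsum\<close> is only meaningful on finite sets.\<close>

definition internal_direct_sum :: "('a, 'b) ring_scheme \<Rightarrow> 'i set \<Rightarrow> ('i \<Rightarrow> 'a set) \<Rightarrow> bool"
  where "internal_direct_sum M I S \<longleftrightarrow>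
    (\<forall>i\<in>I. additive_subgroup (S i) M) \<and>
    (\<forall>x\<in>carrier M. \<exists>!f. f \<in> (\<Pi>\<^sub>E i\<in>I. S i) \<and> finite {i\<in>I. f i \<noteq> \<zero>\<^bsub>M\<^esub>} \<and>
      x = (\<Oplus>\<^bsub>M\<^esub>i\<in>{i\<in>I. f i \<noteq> \<zero>\<^bsub>M\<^esub>}. f i))"

locale graded_ring = grading_monoid: monoid G + R: ring R
  for G :: "('g, 'b) monoid_scheme" (structure) and R :: "('a, 'c) ring_scheme" (structure) +
  fixes A :: "'g \<Rightarrow> 'a set"
  assumes ring_direct_sum: "internal_direct_sum R (carrier G) A"
    and ring_graded_mult: "\<lbrakk>\<gamma> \<in> carrier G; \<delta> \<in> carrier G; a \<in> A \<gamma>; b \<in> A \<delta>\<rbrakk> \<Longrightarrow>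
      a \<otimes>\<^bsub>R\<^esub> b \<in> A (\<gamma> \<otimes>\<^bsub>G\<^esub> \<delta>)"

locale graded_local_ring = graded_ring +
  assumes degree_one_local: "local_ring (R\<lparr>carrier := A \<one>\<^bsub>G\<^esub>\<rparr>)"

locale graded_module = graded_ring G R A + M: left_module R M
  for G :: "('g, 'b) monoid_scheme" (structure) and R :: "('a, 'c) ring_scheme" (structure)
    and A :: "'g \<Rightarrow> 'a set" and M :: "('a, 'm, 'd) module_scheme" (structure) +
  fixes S :: "'g \<Rightarrow> 'm set"
  assumes module_direct_sum: "internal_direct_sum M (carrier G) S"
    and module_graded_smult: "\<lbrakk>\<gamma> \<in> carrier G; \<delta> \<in> carrier G; a \<in> A \<gamma>; x \<in> S \<delta>\<rbrakk> \<Longrightarrow>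
      a \<odot>\<^bsub>M\<^esub> x \<in> S (\<gamma> \<otimes>\<^bsub>G\<^esub> \<delta>)"

locale gr_projective_module = graded_module +
  assumes projective: "projective_module R M"

definition homogeneous_elements ::
  "('g, 'b) monoid_scheme \<Rightarrow> ('a, 'c) ring_scheme \<Rightarrow> ('g \<Rightarrow> 'a set) \<Rightarrow> 'a set"
  where "homogeneous_elements G M S = (\<Union>\<gamma>\<in>carrier G. S \<gamma> - {\<zero>\<^bsub>M\<^esub>})"

definition minimal_homogeneous_generating_set ::
  "('g, 'b) monoid_scheme \<Rightarrow> ('a, 'c) ring_scheme \<Rightarrow> ('a, 'm, 'd) module_scheme \<Rightarrow>
    ('g \<Rightarrow> 'm set) \<Rightarrow> 'm set \<Rightarrow> bool"
  where "minimal_homogeneous_generating_set G R M S T \<longleftrightarrow>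
    T \<subseteq> homogeneous_elements G M S \<and> generates R M T \<and> (\<forall>Y. Y \<subset> T \<longrightarrow> \<not> generates R M Y)"

end

theory Submission
  imports Defs
begin

text \<open>Call a relation among the elements of a minimal homogeneous generating set a syzygy. By
  minimality no coefficient of a syzygy is left invertible. A section of the free cover, which
  exists by projectivity, shows that every homogeneous syzygy \<open>c\<close> satisfies \<open>c = c N\<close>, where the
  rows of the square matrix \<open>N\<close> are again homogeneous syzygies. The diagonal entries of \<open>N\<close> are
  non-units of the local ring \<open>A\<^sub>e\<close>, so Gaussian elimination with the pivots \<open>1 - N j j\<close> applies to
  \<open>c (1 - N) = 0\<close>: each elimination step replaces the rows of \<open>N\<close> by left combinations, which are
  syzygies again, so the next pivot is a unit as well. Hence \<open>c = 0\<close>. Cancelation makes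
  the homogeneous parts of an arbitrary relation well defined, and they are all zero.\<close>

section \<open>Local rings\<close>

context ring
begin

lemma left_idealI:
  assumes "I \<subseteq> carrier R" "\<zero> \<in> I" "\<And>a b. \<lbrakk>a \<in> I; b \<in> I\<rbrakk> \<Longrightarrow> a \<oplus> b \<in> I"
    and smult: "\<And>x a. \<lbrakk>x \<in> carrier R; a \<in> I\<rbrakk> \<Longrightarrow> x \<otimes> a \<in> I"
  shows "left_ideal I R"
proof -
  have "\<ominus> a \<in> I" if "a \<in> I" for a
    using smult[of "\<ominus> \<one>" a] that assms(1) l_minus[of \<one> a] by auto
  then have "additive_subgroup I R"
    using assms(1-3)
    by (intro additive_subgroupI add.subgroupI) (auto simp: a_inv_def[symmetric])
  then show ?thesis
    using smult by (intro left_ideal.intro left_ideal_axioms.intro ring_axioms) auto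
qed

lemma left_ideal_eq_carrier:
  assumes "left_ideal I R" "\<one> \<in> I"
  shows "I = carrier R"
proof -
  interpret I: left_ideal I R by fact
  have "x \<in> I" if "x \<in> carrier R" for x
    using I.I_l_closed[OF assms(2) that] that by simp
  then show ?thesis using I.a_subset by auto
qed

text \<open>Zorn's lemma on the left ideals that contain \<open>x\<close> and omit 1. The principal
  left ideal \<open>R x\<close> starts the family, because \<open>x\<close> has no left
  inverse.\<close>

lemma ex_maximal_left_ideal:
  assumes x: "x \<in> carrier R" and inv: "\<And>y. y \<in> carrier R \<Longrightarrow> y \<otimes> x \<noteq> \<one>"
  shows "\<exists>I. maximal_left_ideal I R \<and> x \<in> I"
proof -
  define \<A> where "\<A> = {J. left_ideal J R \<and> x \<in> J \<and> \<one> \<notin> J}"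
  have "left_ideal ((\<lambda>y. y \<otimes> x) ` carrier R) R"
  proof (rule left_idealI)
    fix a b assume "a \<in> (\<lambda>y. y \<otimes> x) ` carrier R" "b \<in> (\<lambda>y. y \<otimes> x) ` carrier R"
    then show "a \<oplus> b \<in> (\<lambda>y. y \<otimes> x) ` carrier R"
      using x by (auto simp: l_distr[symmetric])
  next
    fix y a assume "y \<in> carrier R" "a \<in> (\<lambda>y. y \<otimes> x) ` carrier R"
    then show "y \<otimes> a \<in> (\<lambda>y. y \<otimes> x) ` carrier R"
      using x by (auto simp: m_assoc[symmetric])
  next
    show "\<zero> \<in> (\<lambda>y. y \<otimes> x) ` carrier R"
      using x by (intro image_eqI[of _ _ \<zero>]) auto
  qed (use x in auto)
  moreover have "x \<in> (\<lambda>y. y \<otimes> x) ` carrier R"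
    using x by (intro image_eqI[of _ _ \<one>]) auto
  moreover have "\<one> \<notin> (\<lambda>y. y \<otimes> x) ` carrier R"
    using inv by (metis imageE)
  ultimately have "\<A> \<noteq> {}"
    unfolding \<A>_def by blast
  moreover have "\<Union>\<C> \<in> \<A>" if "\<C> \<noteq> {}" and chain: "subset.chain \<A> \<C>" for \<C>
  proof -
    have C: "left_ideal J R" "x \<in> J" "\<one> \<notin> J" if "J \<in> \<C>" for J
      using that chain by (auto simp: \<A>_def subset_chain_def)
    note sub = additive_subgroup.a_subset[OF left_ideal.axioms(1)[OF C(1)]]
      additive_subgroup.zero_closed[OF left_ideal.axioms(1)[OF C(1)]]
      additive_subgroup.a_closed[OF left_ideal.axioms(1)[OF C(1)]]
    have "left_ideal (\<Union>\<C>) R"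
    proof (rule left_idealI)
      show "\<Union>\<C> \<subseteq> carrier R" using sub(1) by blast
      show "\<zero> \<in> \<Union>\<C>" using sub(2) \<open>\<C> \<noteq> {}\<close> by blast
      show "y \<otimes> a \<in> \<Union>\<C>" if "y \<in> carrier R" "a \<in> \<Union>\<C>" for y a
        using that left_ideal.I_l_closed[OF C(1)] by blast
      \<comment> \<open>Two elements of the union of a chain lie in a common member.\<close>
      fix a b assume "a \<in> \<Union>\<C>" "b \<in> \<Union>\<C>"
      then obtain J where "J \<in> \<C>" "a \<in> J" "b \<in> J"
        using chain unfolding subset_chain_def by blast
      then show "a \<oplus> b \<in> \<Union>\<C>" using sub(3) by blast
    qed
    then show ?thesis using C \<open>\<C> \<noteq> {}\<close> by (auto simp: \<A>_def)
  qed
  ultimately obtain I where I: "I \<in> \<A>" and max: "\<And>J. \<lbrakk>J \<in> \<A>; I \<subseteq> J\<rbrakk> \<Longrightarrow> J = I"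
    using subset_Zorn_nonempty[of \<A>] by blast
  have "maximal_left_ideal I R"
  proof (intro maximal_left_ideal.intro maximal_left_ideal_axioms.intro)
    show "left_ideal I R" "carrier R \<noteq> I" using I by (auto simp: \<A>_def)
    \<comment> \<open>Such a \<open>J\<close> contains \<open>x\<close>. If it omits 1, it lies in
      \<open>\<A>\<close> and equals \<open>I\<close>; otherwise it is the whole ring.\<close>
    fix J assume "left_ideal J R" "I \<subseteq> J" "J \<subseteq> carrier R"
    then show "J = I \<or> J = carrier R"
      using left_ideal_eq_carrier[of J] max[of J] I by (auto simp: \<A>_def)
  qed
  then show ?thesis using I by (auto simp: \<A>_def)
qed

end

text \<open>Every element outside the unique maximal left ideal \<open>I\<close> has a left inverse.
  Since \<open>x\<close> lies in \<open>I\<close>, \<open>y\<close> does not and has a left inverse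
  \<open>u\<close>. As \<open>u\<close> is outside \<open>I\<close> too, it has a left inverse in
  turn, and this can only be \<open>y\<close>.\<close>

lemma (in local_ring) right_inverse_of_complement:
  assumes x: "x \<in> carrier R" and y: "y \<in> carrier R" and xy: "x \<oplus> y = \<one>"
    and inv: "\<And>b. b \<in> carrier R \<Longrightarrow> b \<otimes> x \<noteq> \<one>"
  shows "\<exists>u\<in>carrier R. y \<otimes> u = \<one>"
proof -
  obtain I where I: "maximal_left_ideal I R"
    and uniq: "\<And>J. maximal_left_ideal J R \<Longrightarrow> J = I"
    using unique_maximal_left_ideal by blast
  interpret I: maximal_left_ideal I R by (rule I)
  have xI: "x \<in> I" using ex_maximal_left_ideal[OF x inv] uniq by auto
  have one: "\<one> \<notin> I" using left_ideal_eq_carrier[OF I.left_ideal_axioms] I.I_notcarr by auto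
  have left_inv: "\<exists>b\<in>carrier R. b \<otimes> z = \<one>" if "z \<in> carrier R" "z \<notin> I" for z
    using ex_maximal_left_ideal[OF that(1)] uniq that(2) by auto
  have "y \<notin> I" using xI xy one I.a_closed by metis
  then obtain u where u: "u \<in> carrier R" "u \<otimes> y = \<one>" using left_inv y by auto
  \<comment> \<open>Multiply \<open>x \<oplus> y = \<one>\<close> by \<open>u\<close> from the left.
    If \<open>u\<close> were in \<open>I\<close>, this equation would force 1 into
    \<open>I\<close>.\<close>
  have ux: "u = u \<otimes> x \<oplus> \<one>"
    using r_distr[of x y u] u x y xy by simp
  have "u \<notin> I"
  proof
    assume "u \<in> I"
    then have "\<one> = \<ominus> (u \<otimes> x) \<oplus> u" "\<ominus> (u \<otimes> x) \<oplus> u \<in> I"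
      using ux u(1) x xI I.I_l_closed I.a_inv_closed
      by (metis m_closed one_closed r_neg1, metis I.a_closed)
    with one show False by simp
  qed
  then obtain v where v: "v \<in> carrier R" "v \<otimes> u = \<one>" using left_inv u by auto
  have "v = v \<otimes> (u \<otimes> y)" using u v by simp
  also have "\<dots> = y" using u(1) v y by (simp add: m_assoc[symmetric])
  finally show ?thesis using v u by auto
qed


section \<open>Internal direct sums\<close>

text \<open>Over an infinite index set both sums take the default value zero, which \<open>h\<close>
  preserves. Components, quotient parts and coordinates of a section are the maps of
  interest.\<close>

lemma additive_map_finsum:
  assumes "abelian_group M" "abelian_group N"
    and h: "h \<in> carrier M \<rightarrow> carrier N"
    and add: "\<And>x y. \<lbrakk>x \<in> carrier M; y \<in> carrier M\<rbrakk> \<Longrightarrow> h (x \<oplus>\<^bsub>M\<^esub> y) = h x \<oplus>\<^bsub>N\<^esub> h y"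
    and "f \<in> F \<rightarrow> carrier M"
  shows "h (\<Oplus>\<^bsub>M\<^esub>i\<in>F. f i) = (\<Oplus>\<^bsub>N\<^esub>i\<in>F. h (f i))"
proof -
  interpret M: abelian_group M by fact
  interpret N: abelian_group N by fact
  have h0: "h \<zero>\<^bsub>M\<^esub> = \<zero>\<^bsub>N\<^esub>"
    using add[of "\<zero>\<^bsub>M\<^esub>" "\<zero>\<^bsub>M\<^esub>"] h N.add.r_cancel_one'[of "h \<zero>\<^bsub>M\<^esub>" "h \<zero>\<^bsub>M\<^esub>"] by auto
  show ?thesis using \<open>f \<in> F \<rightarrow> carrier M\<close>
    by (induction F rule: infinite_finite_induct) (use h h0 add in \<open>auto simp: Pi_def\<close>)
qed

text \<open>Shared by the grading of the ring and the grading of the module.\<close>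

locale direct_sum = abelian_group M for M (structure) +
  fixes I :: "'i set" and S :: "'i \<Rightarrow> 'a set"
  assumes direct_sum: "internal_direct_sum M I S"
begin

lemma summand: "i \<in> I \<Longrightarrow> additive_subgroup (S i) M"
  using direct_sum by (simp add: internal_direct_sum_def)

lemma summand_closed: "\<lbrakk>i \<in> I; x \<in> S i\<rbrakk> \<Longrightarrow> x \<in> carrier M"
  using additive_subgroup.a_subset[OF summand] by auto

text \<open>Projection to the \<open>i\<close>-th summand. The description picks the family whose
  unique existence is asserted by \<open>internal_direct_sum\<close>, so the value is meaningful for
  \<open>x\<close> in the carrier and \<open>i\<close> in \<open>I\<close>.\<close>

definition component :: "'i \<Rightarrow> 'a \<Rightarrow> 'a"
  where "component i x =
    (THE f. f \<in> (\<Pi>\<^sub>E i\<in>I. S i) \<and> finite {i\<in>I. f i \<noteq> \<zero>} \<and>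
      x = (\<Oplus>i\<in>{i\<in>I. f i \<noteq> \<zero>}. f i)) i"

lemma component_props:
  assumes "x \<in> carrier M"
  shows "i \<in> I \<Longrightarrow> component i x \<in> S i" "finite {i\<in>I. component i x \<noteq> \<zero>}"
    "x = (\<Oplus>i\<in>{i\<in>I. component i x \<noteq> \<zero>}. component i x)"
proof -
  let ?P = "\<lambda>f. f \<in> (\<Pi>\<^sub>E i\<in>I. S i) \<and> finite {i\<in>I. f i \<noteq> \<zero>} \<and>
      x = (\<Oplus>i\<in>{i\<in>I. f i \<noteq> \<zero>}. f i)"
  have "\<exists>!f. ?P f" using direct_sum assms by (simp add: internal_direct_sum_def)
  then have "?P (THE f. ?P f)" by (rule theI')
  moreover have "(THE f. ?P f) = (\<lambda>i. component i x)" by (auto simp: component_def)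
  ultimately have *: "?P (\<lambda>i. component i x)" by simp
  then show "i \<in> I \<Longrightarrow> component i x \<in> S i" by (auto simp: PiE_def Pi_def)
  from * show "finite {i\<in>I. component i x \<noteq> \<zero>}"
    "x = (\<Oplus>i\<in>{i\<in>I. component i x \<noteq> \<zero>}. component i x)" by blast+
qed

lemma component_closed: "\<lbrakk>i \<in> I; x \<in> carrier M\<rbrakk> \<Longrightarrow> component i x \<in> carrier M"
  using component_props(1) summand_closed by blast

text \<open>The family \<open>f\<close>, padded with zeros to an extensional family on
  \<open>I\<close>, is an admissible decomposition of its sum; uniqueness makes it the family of
  components.\<close>

lemma component_sum:
  assumes F: "finite F" "F \<subseteq> I" and f: "\<And>i. i \<in> F \<Longrightarrow> f i \<in> S i" and j: "j \<in> I"
  shows "component j (\<Oplus>i\<in>F. f i) = (if j \<in> F then f j else \<zero>)"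
proof -
  let ?x = "\<Oplus>i\<in>F. f i"
  let ?P = "\<lambda>g. g \<in> (\<Pi>\<^sub>E i\<in>I. S i) \<and> finite {i\<in>I. g i \<noteq> \<zero>} \<and>
      ?x = (\<Oplus>i\<in>{i\<in>I. g i \<noteq> \<zero>}. g i)"
  define g where "g = (\<lambda>i\<in>I. if i \<in> F then f i else \<zero>)"
  have fc: "f \<in> F \<rightarrow> carrier M" using f F summand_closed by blast
  have "g \<in> (\<Pi>\<^sub>E i\<in>I. S i)"
    using f additive_subgroup.zero_closed[OF summand] by (auto simp: g_def)
  moreover have sub: "{i\<in>I. g i \<noteq> \<zero>} \<subseteq> F" by (auto simp: g_def)
  moreover have "(\<Oplus>i\<in>{i\<in>I. g i \<noteq> \<zero>}. g i) = ?x"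
    using F fc sub by (intro add.finprod_mono_neutral_cong_left) (auto simp: g_def)
  ultimately have "?P g" using F by (auto intro: finite_subset)
  moreover have "\<exists>!g. ?P g"
    using direct_sum fc by (auto simp: internal_direct_sum_def)
  ultimately have "(THE g. ?P g) = g" by (rule the1_equality[rotated])
  then show ?thesis using j by (simp add: component_def g_def)
qed

lemma component_homogeneous:
  assumes "i \<in> I" "x \<in> S i" "j \<in> I"
  shows "component j x = (if j = i then x else \<zero>)"
  using component_sum[of "{i}" "\<lambda>_. x" j] assms summand_closed by auto

text \<open>\<open>F\<close> may exceed the support, so that two elements can be expanded over a
  common index set.\<close>

lemma sum_components:
  assumes "x \<in> carrier M" "finite F" "F \<subseteq> I" "{i\<in>I. component i x \<noteq> \<zero>} \<subseteq> F"
  shows "x = (\<Oplus>i\<in>F. component i x)"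
proof -
  have "(\<Oplus>i\<in>{i\<in>I. component i x \<noteq> \<zero>}. component i x) = (\<Oplus>i\<in>F. component i x)"
    using assms component_closed by (intro add.finprod_mono_neutral_cong_left) auto
  then show ?thesis using component_props(3)[OF assms(1)] by simp
qed

text \<open>Both elements are expanded over the union of their supports and added termwise;
  \<open>component_sum\<close> then reads off the components.\<close>

lemma component_add:
  assumes x: "x \<in> carrier M" and y: "y \<in> carrier M" and j: "j \<in> I"
  shows "component j (x \<oplus> y) = component j x \<oplus> component j y"
proof -
  let ?F = "{i\<in>I. component i x \<noteq> \<zero>} \<union> {i\<in>I. component i y \<noteq> \<zero>}"
  have F: "finite ?F" "?F \<subseteq> I" using component_props(2) x y by auto
  have "x \<oplus> y = (\<Oplus>i\<in>?F. component i x \<oplus> component i y)"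
    using sum_components[OF x F] sum_components[OF y F] component_closed x y F
    by (subst finsum_addf) auto
  moreover have closed: "component i x \<oplus> component i y \<in> S i" if "i \<in> ?F" for i
    using that component_props(1) x y additive_subgroup.a_closed[OF summand] by blast
  ultimately have "component j (x \<oplus> y) = (if j \<in> ?F then component j x \<oplus> component j y else \<zero>)"
    by (simp only: component_sum[OF F closed j])
  then show ?thesis using j by auto
qed

lemma component_finsum:
  assumes "f \<in> F \<rightarrow> carrier M" "j \<in> I"
  shows "component j (\<Oplus>i\<in>F. f i) = (\<Oplus>i\<in>F. component j (f i))"
  using assms component_add component_closed abelian_group_axioms
  by (intro additive_map_finsum) auto

lemma component_zero: "j \<in> I \<Longrightarrow> component j \<zero> = \<zero>"
  using component_finsum[of undefined "{}"] by simp

text \<open>Every element is a finite sum of its components, so additive identities need checking on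
  homogeneous elements only. The case of zero accounts for the empty sum.\<close>

lemma homogeneous_induct [consumes 1, case_names zero homogeneous add]:
  assumes x: "x \<in> carrier M"
    and zero: "Q \<zero>"
    and hom: "\<And>i x. \<lbrakk>i \<in> I; x \<in> S i\<rbrakk> \<Longrightarrow> Q x"
    and add: "\<And>x y. \<lbrakk>x \<in> carrier M; y \<in> carrier M; Q x; Q y\<rbrakk> \<Longrightarrow> Q (x \<oplus> y)"
  shows "Q x"
proof -
  have "Q (\<Oplus>i\<in>F. f i)" if "finite F" "F \<subseteq> I" "\<And>i. i \<in> F \<Longrightarrow> f i \<in> S i" for F and f :: "'i \<Rightarrow> 'a"
    using that
  proof (induction F)
    case (insert i F)
    then have "f \<in> F \<rightarrow> carrier M" "f i \<in> carrier M" using summand_closed by auto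
    then show ?case using insert hom add[of "f i" "\<Oplus>i\<in>F. f i"] by (auto intro: finsum_closed)
  qed (simp add: zero)
  moreover have "{i\<in>I. component i x \<noteq> \<zero>} \<subseteq> I" by blast
  ultimately show ?thesis
    using component_props[OF x] by (metis (no_types, lifting) mem_Collect_eq)
qed

end


section \<open>Generating sets\<close>

context left_module
begin

text \<open>Negatives come for free, as multiples by -1.\<close>

lemma submoduleI:
  assumes "H \<subseteq> carrier M" "\<zero>\<^bsub>M\<^esub> \<in> H"
    and "\<And>x y. \<lbrakk>x \<in> H; y \<in> H\<rbrakk> \<Longrightarrow> x \<oplus>\<^bsub>M\<^esub> y \<in> H"
    and smult: "\<And>a x. \<lbrakk>a \<in> carrier R; x \<in> H\<rbrakk> \<Longrightarrow> a \<odot>\<^bsub>M\<^esub> x \<in> H"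
  shows "submodule H R M"
proof -
  have "\<ominus>\<^bsub>M\<^esub> x \<in> H" if "x \<in> H" for x
  proof -
    have x: "x \<in> carrier M" using that assms(1) by auto
    have "(\<ominus> \<one>) \<odot>\<^bsub>M\<^esub> x \<oplus>\<^bsub>M\<^esub> x = (\<ominus> \<one> \<oplus> \<one>) \<odot>\<^bsub>M\<^esub> x"
      using x by (subst smult_l_distr) auto
    also have "\<dots> = \<zero>\<^bsub>M\<^esub>" using x by (simp add: R.l_neg)
    finally have "\<ominus>\<^bsub>M\<^esub> x = (\<ominus> \<one>) \<odot>\<^bsub>M\<^esub> x"
      using x by (intro M.minus_equality) auto
    then show ?thesis using smult[of "\<ominus> \<one>" x] that by simp
  qed
  then have "subgroup H (add_monoid M)"
    using assms(1-3) by (intro M.add.subgroupI) (auto simp: a_inv_def[symmetric])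
  then show ?thesis
    using smult by (intro submodule.intro submodule_axioms.intro)
qed

lemma submoduleD:
  assumes "submodule H R M"
  shows "H \<subseteq> carrier M" "\<zero>\<^bsub>M\<^esub> \<in> H"
    and "\<And>x y. \<lbrakk>x \<in> H; y \<in> H\<rbrakk> \<Longrightarrow> x \<oplus>\<^bsub>M\<^esub> y \<in> H"
    and "\<And>x. x \<in> H \<Longrightarrow> \<ominus>\<^bsub>M\<^esub> x \<in> H"
    and "\<And>a x. \<lbrakk>a \<in> carrier R; x \<in> H\<rbrakk> \<Longrightarrow> a \<odot>\<^bsub>M\<^esub> x \<in> H"
proof -
  interpret H: submodule H R M by fact
  interpret additive_subgroup H M by (rule additive_subgroupI) (rule H.subgroup_axioms)
  show "H \<subseteq> carrier M" "\<zero>\<^bsub>M\<^esub> \<in> H"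
    "\<And>x y. \<lbrakk>x \<in> H; y \<in> H\<rbrakk> \<Longrightarrow> x \<oplus>\<^bsub>M\<^esub> y \<in> H"
    "\<And>x. x \<in> H \<Longrightarrow> \<ominus>\<^bsub>M\<^esub> x \<in> H"
    "\<And>a x. \<lbrakk>a \<in> carrier R; x \<in> H\<rbrakk> \<Longrightarrow> a \<odot>\<^bsub>M\<^esub> x \<in> H"
    using a_subset by auto
qed

lemma submodule_finsum:
  assumes "submodule H R M" "f \<in> F \<rightarrow> H"
  shows "(\<Oplus>\<^bsub>M\<^esub>i\<in>F. f i) \<in> H"
  using assms(2)
proof (induction F rule: infinite_finite_induct)
  case (insert i F)
  then have "f \<in> F \<rightarrow> carrier M" "f i \<in> carrier M"
    using submoduleD(1)[OF assms(1)] by auto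
  then show ?case using insert submoduleD(3)[OF assms(1)] by auto
qed (use submoduleD(2)[OF assms(1)] in simp_all)

lemma submodule_carrier: "submodule (carrier M) R M"
  by (rule submoduleI) auto

lemma generatesI:
  assumes "T \<subseteq> carrier M" "\<And>H. \<lbrakk>submodule H R M; T \<subseteq> H\<rbrakk> \<Longrightarrow> carrier M \<subseteq> H"
  shows "generates R M T"
  unfolding generates_def using assms submodule_carrier by blast

lemma generatesD:
  assumes "generates R M T" "submodule H R M" "T \<subseteq> H"
  shows "H = carrier M"
  using assms submoduleD(1)[OF assms(2)] unfolding generates_def by blast

lemma generates_trans:
  assumes T: "generates R M T" and U: "U \<subseteq> carrier M"
    and sub: "\<And>H. \<lbrakk>submodule H R M; U \<subseteq> H\<rbrakk> \<Longrightarrow> T \<subseteq> H"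
  shows "generates R M U"
proof (rule generatesI[OF U])
  fix H assume "submodule H R M" "U \<subseteq> H"
  then show "carrier M \<subseteq> H" using generatesD[OF T] sub by blast
qed

text \<open>The elements lying in the span of some finite part of \<open>X\<close> form a submodule
  containing \<open>X\<close>, hence everything. The finite parts needed for a finite generating set
  \<open>T\<close> together generate. This makes minimal generating sets finite.\<close>

lemma finite_generating_subset:
  assumes fg: "finitely_generated R M" and X: "generates R M X"
  obtains F where "finite F" "F \<subseteq> X" "generates R M F"
proof -
  obtain T where T: "finite T" "generates R M T"
    using fg by (auto simp: finitely_generated_def)
  have XM: "X \<subseteq> carrier M" using X by (simp add: generates_def)
  \<comment> \<open>The last conjunct expresses that \<open>x\<close> is in the span of
    \<open>F\<close>.\<close>
  define Q where "Q F x \<longleftrightarrow> finite F \<and> F \<subseteq> X \<and>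
    (\<forall>H. submodule H R M \<and> F \<subseteq> H \<longrightarrow> x \<in> H)" for F x
  define K where "K = {x \<in> carrier M. \<exists>F. Q F x}"
  have "submodule K R M"
  proof (rule submoduleI)
    have "Q {} \<zero>\<^bsub>M\<^esub>" using submoduleD(2) by (simp add: Q_def)
    then show "\<zero>\<^bsub>M\<^esub> \<in> K" unfolding K_def by auto
  next
    fix x y assume "x \<in> K" "y \<in> K"
    then obtain F1 F2 where F: "Q F1 x" "Q F2 y" and xy: "x \<in> carrier M" "y \<in> carrier M"
      by (auto simp: K_def)
    have "x \<oplus>\<^bsub>M\<^esub> y \<in> H" if "submodule H R M" "F1 \<union> F2 \<subseteq> H" for H
      using that F by (intro submoduleD(3)) (auto simp: Q_def)
    then have "Q (F1 \<union> F2) (x \<oplus>\<^bsub>M\<^esub> y)" using F by (auto simp: Q_def)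
    then show "x \<oplus>\<^bsub>M\<^esub> y \<in> K" using xy by (auto simp: K_def)
  next
    fix a x assume a: "a \<in> carrier R" and "x \<in> K"
    then obtain F where F: "Q F x" and x: "x \<in> carrier M" by (auto simp: K_def)
    have "Q F (a \<odot>\<^bsub>M\<^esub> x)" using F submoduleD(5) a by (simp add: Q_def)
    then show "a \<odot>\<^bsub>M\<^esub> x \<in> K" using a x by (auto simp: K_def)
  qed (auto simp: K_def)
  moreover have "X \<subseteq> K"
  proof
    fix x assume "x \<in> X"
    then have "Q {x} x" "x \<in> carrier M" using XM by (auto simp: Q_def)
    then show "x \<in> K" by (auto simp: K_def)
  qed
  ultimately have "K = carrier M" by (rule generatesD[OF X])
  then have "\<forall>t\<in>T. \<exists>F. Q F t" using T(2) by (auto simp: generates_def K_def)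
  from bchoice[OF this] obtain \<Phi> where "\<forall>t\<in>T. Q (\<Phi> t) t" by blast
  then have \<Phi>: "finite (\<Phi> t)" "\<Phi> t \<subseteq> X" "\<lbrakk>submodule H R M; \<Phi> t \<subseteq> H\<rbrakk> \<Longrightarrow> t \<in> H"
    if "t \<in> T" for t H
    using that by (auto simp: Q_def)
  have "generates R M (\<Union>t\<in>T. \<Phi> t)"
  proof (rule generates_trans[OF T(2)])
    show "(\<Union>t\<in>T. \<Phi> t) \<subseteq> carrier M" using \<Phi>(2) XM by blast
    show "T \<subseteq> H" if "submodule H R M" "(\<Union>t\<in>T. \<Phi> t) \<subseteq> H" for H
      using \<Phi>(3) that by blast
  qed
  moreover have "finite (\<Union>t\<in>T. \<Phi> t)" using T(1) \<Phi>(1) by blast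
  moreover have "(\<Union>t\<in>T. \<Phi> t) \<subseteq> X" using \<Phi>(2) by blast
  ultimately show thesis by (rule that[rotated 2])
qed

section \<open>Syzygies of a generating set\<close>

definition syzygy :: "'m set \<Rightarrow> ('m \<Rightarrow> 'a) \<Rightarrow> bool"
  where "syzygy X c \<longleftrightarrow> c \<in> X \<rightarrow> carrier R \<and> (\<Oplus>\<^bsub>M\<^esub>x\<in>X. c x \<odot>\<^bsub>M\<^esub> x) = \<zero>\<^bsub>M\<^esub>"

text \<open>A left inverse of the coefficient of \<open>x\<close> would express \<open>x\<close>
  through the other generators, so that \<open>X - {x}\<close> would still generate.\<close>

lemma syzygy_coefficient_not_invertible:
  assumes X: "finite X" "generates R M X" and min: "\<And>Y. Y \<subset> X \<Longrightarrow> \<not> generates R M Y"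
    and c: "syzygy X c" and x: "x \<in> X" and b: "b \<in> carrier R"
  shows "b \<otimes> c x \<noteq> \<one>"
proof
  assume bc: "b \<otimes> c x = \<one>"
  have XM: "X \<subseteq> carrier M" using X by (simp add: generates_def)
  have cR: "c y \<in> carrier R" if "y \<in> X" for y using c that by (auto simp: syzygy_def)
  have "generates R M (X - {x})"
  proof (rule generates_trans[OF X(2)])
    show "X - {x} \<subseteq> carrier M" using XM by auto
    fix H assume H: "submodule H R M" "X - {x} \<subseteq> H"
    define s where "s = (\<Oplus>\<^bsub>M\<^esub>y\<in>X - {x}. c y \<odot>\<^bsub>M\<^esub> y)"
    have s: "s \<in> H" unfolding s_def
      using H cR submoduleD(5)[OF H(1)] by (intro submodule_finsum) auto
    have sM: "s \<in> carrier M" using s submoduleD(1)[OF H(1)] by auto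
    have xM: "x \<in> carrier M" using x XM by auto
    have "X = insert x (X - {x})" using x by auto
    then have "c x \<odot>\<^bsub>M\<^esub> x \<oplus>\<^bsub>M\<^esub> s = \<zero>\<^bsub>M\<^esub>"
      using c M.finsum_insert[of "X - {x}" x "\<lambda>y. c y \<odot>\<^bsub>M\<^esub> y"] X(1) cR XM x
      unfolding s_def syzygy_def by (auto simp: subset_iff)
    then have "c x \<odot>\<^bsub>M\<^esub> x = \<ominus>\<^bsub>M\<^esub> s"
      using cR[OF x] xM sM by (intro M.minus_equality[symmetric]) auto
    then have "c x \<odot>\<^bsub>M\<^esub> x \<in> H" using submoduleD(4)[OF H(1) s] by simp
    then have "b \<odot>\<^bsub>M\<^esub> (c x \<odot>\<^bsub>M\<^esub> x) \<in> H" using submoduleD(5)[OF H(1)] b by blast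
    then have "x \<in> H" using smult_assoc1[OF b cR[OF x] xM] bc xM by simp
    then show "X \<subseteq> H" using H(2) by auto
  qed
  then show False using min[of "X - {x}"] x by blast
qed

end

text \<open>The coordinates of a section of the free cover on \<open>X\<close>.\<close>

lemma (in left_module) projective_coordinates:
  assumes proj: "projective_module R M" and X: "finite X" "generates R M X"
  obtains E where "\<And>x y. x \<in> X \<Longrightarrow> E x y \<in> carrier R"
    "\<And>x. x \<in> X \<Longrightarrow> (\<Oplus>\<^bsub>M\<^esub>y\<in>X. E x y \<odot>\<^bsub>M\<^esub> y) = x"
    "\<And>c y. syzygy X c \<Longrightarrow> (\<Oplus>x\<in>X. c x \<otimes> E x y) = \<zero>"
proof -
  define F where "F = free_on R X"
  interpret F: left_module R F unfolding F_def by (rule R.free_on_left_module)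
  have XM: "X \<subseteq> carrier M" using X by (simp add: generates_def)
  define \<pi> where "\<pi> = lin_ext R M id"
  have \<pi>: "\<pi> \<in> left_module_hom R F M"
    unfolding \<pi>_def F_def using XM by (intro lin_ext_hom) auto
  have \<pi>_eq: "\<pi> c = (\<Oplus>\<^bsub>M\<^esub>y\<in>X. c y \<odot>\<^bsub>M\<^esub> y)" if "c \<in> carrier F" for c
  proof -
    have "id \<in> X \<rightarrow> carrier M" using XM by auto
    then show ?thesis
      using lin_ext_superset[of c X id X] that X(1) by (simp add: \<pi>_def F_def free_on_def)
  qed
  \<comment> \<open>The image of \<open>\<pi>\<close> is a submodule containing \<open>X\<close>, so
    \<open>\<pi>\<close> is surjective.\<close>
  have "submodule (\<pi> ` carrier F) R M"
  proof (rule submoduleI)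
    show "\<pi> ` carrier F \<subseteq> carrier M" using \<pi> by (auto simp: left_module_hom_def)
    have "\<pi> \<zero>\<^bsub>F\<^esub> = \<pi> (\<zero> \<odot>\<^bsub>F\<^esub> \<zero>\<^bsub>F\<^esub>)" by simp
    also have "\<dots> = \<zero> \<odot>\<^bsub>M\<^esub> \<pi> \<zero>\<^bsub>F\<^esub>"
      using \<pi> F.M.zero_closed R.zero_closed unfolding left_module_hom_def by blast
    also have "\<dots> = \<zero>\<^bsub>M\<^esub>"
      using \<pi> F.M.zero_closed unfolding left_module_hom_def by (intro smult_l_null) blast
    finally show "\<zero>\<^bsub>M\<^esub> \<in> \<pi> ` carrier F" using F.M.zero_closed by (metis imageI)
  next
    fix x y assume "x \<in> \<pi> ` carrier F" "y \<in> \<pi> ` carrier F"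
    then obtain c d where "c \<in> carrier F" "x = \<pi> c" "d \<in> carrier F" "y = \<pi> d" by auto
    then show "x \<oplus>\<^bsub>M\<^esub> y \<in> \<pi> ` carrier F"
      using \<pi> by (intro image_eqI[of _ _ "c \<oplus>\<^bsub>F\<^esub> d"]) (auto simp: left_module_hom_def)
  next
    fix a x assume "a \<in> carrier R" "x \<in> \<pi> ` carrier F"
    moreover from this obtain c where "c \<in> carrier F" "x = \<pi> c" by auto
    ultimately show "a \<odot>\<^bsub>M\<^esub> x \<in> \<pi> ` carrier F"
      using \<pi> by (intro image_eqI[of _ _ "a \<odot>\<^bsub>F\<^esub> c"]) (auto simp: left_module_hom_def)
  qed
  moreover have "X \<subseteq> \<pi> ` carrier F"
  proof
    fix x assume x: "x \<in> X"
    \<comment> \<open>The standard basis vector at \<open>x\<close>.\<close>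
    define c where "c = (\<lambda>i. if i = x then \<one> else \<zero>)"
    have sub: "{i. c i \<noteq> \<zero>} \<subseteq> {x}" by (auto simp: c_def)
    then have c: "c \<in> carrier F"
      using x finite_subset[OF sub] by (auto simp: F_def free_on_def c_def)
    have "\<pi> c = (\<Oplus>\<^bsub>M\<^esub>i\<in>{x}. c i \<odot>\<^bsub>M\<^esub> id i)"
      unfolding \<pi>_def using c sub x XM
      by (intro lin_ext_superset[of c X]) (auto simp: F_def)
    also have "\<dots> = x" using x XM by (auto simp: c_def)
    finally show "x \<in> \<pi> ` carrier F" using c by force
  qed
  ultimately have surj: "\<pi> ` carrier F = carrier M" by (rule generatesD[OF X(2)])
  \<comment> \<open>Lifting the identity along \<open>\<pi>\<close> gives a section
    \<open>h\<close>; the coordinates \<open>h x y\<close> serve as \<open>E x y\<close>.\<close>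
  have "id \<in> left_module_hom R M M" by (auto simp: left_module_hom_def)
  then obtain h where h: "h \<in> left_module_hom R M F" "\<And>x. x \<in> carrier M \<Longrightarrow> \<pi> (h x) = x"
    using projective_module_lift[OF proj F.left_module_axioms left_module_axioms \<pi> surj, of id]
    by auto
  have hF: "h x \<in> carrier F" if "x \<in> carrier M" for x
    using h(1) that by (auto simp: left_module_hom_def)
  then have hR: "h x y \<in> carrier R" if "x \<in> carrier M" for x y
    using that by (auto simp: F_def free_on_def)
  show thesis
  proof (rule that[of h])
    show "h x y \<in> carrier R" if "x \<in> X" for x y using that XM hR by auto
    show "(\<Oplus>\<^bsub>M\<^esub>y\<in>X. h x y \<odot>\<^bsub>M\<^esub> y) = x" if "x \<in> X" for x
      using that XM \<pi>_eq[of "h x"] h(2)[of x] hF by auto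
    fix c y assume c: "syzygy X c"
    have cR: "c x \<in> carrier R" if "x \<in> X" for x using c that by (auto simp: syzygy_def)
    \<comment> \<open>Each coordinate of \<open>h\<close> is additive, so \<open>h\<close> can be
      applied to the relation \<open>c\<close> termwise. The empty sum yields that \<open>h\<close>
      maps zero to zero.\<close>
    have sum: "h (\<Oplus>\<^bsub>M\<^esub>i\<in>J. f i) y = (\<Oplus>i\<in>J. h (f i) y)"
      if "f \<in> J \<rightarrow> carrier M" for f :: "'m \<Rightarrow> 'm" and J
    proof (rule additive_map_finsum)
      show "h (x \<oplus>\<^bsub>M\<^esub> z) y = h x y \<oplus> h z y" if "x \<in> carrier M" "z \<in> carrier M" for x z
        using h(1) that by (simp add: left_module_hom_def F_def free_on_def)
    qed (use that hR in \<open>auto intro: M.abelian_group_axioms R.is_abelian_group\<close>)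
    have "(\<Oplus>x\<in>X. c x \<otimes> h x y) = (\<Oplus>x\<in>X. h (c x \<odot>\<^bsub>M\<^esub> x) y)"
    proof (rule R.finsum_cong')
      show "c x \<otimes> h x y = h (c x \<odot>\<^bsub>M\<^esub> x) y" if "x \<in> X" for x
        using h(1) that cR XM by (auto simp: left_module_hom_def F_def free_on_def)
    qed (use cR XM hR in auto)
    also have "\<dots> = h (\<Oplus>\<^bsub>M\<^esub>x\<in>X. c x \<odot>\<^bsub>M\<^esub> x) y"
      using cR XM by (intro sum[symmetric]) auto
    also have "\<dots> = h \<zero>\<^bsub>M\<^esub> y" using c by (simp add: syzygy_def)
    also have "\<dots> = \<zero>" using sum[of undefined "{}"] by simp
    finally show "(\<Oplus>x\<in>X. c x \<otimes> h x y) = \<zero>" .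
  qed
qed


section \<open>Gradings by cancelation monoids\<close>

sublocale graded_ring \<subseteq> ring_sum: direct_sum R "carrier G" A
  using ring_direct_sum by unfold_locales

sublocale graded_module \<subseteq> module_sum: direct_sum M "carrier G" S
  using module_direct_sum by unfold_locales

locale cancel_graded_ring = graded_ring + monoid_cancel G
begin

text \<open>The part of \<open>a\<close> that carries degree \<beta> to degree \<gamma>, formally
  its component of degree \<open>\<gamma> / \<beta>\<close>. Right cancelation leaves at most one
  such quotient; if there is none, the part is zero.\<close>

definition quotient_part :: "'a \<Rightarrow> 'a \<Rightarrow> 'c \<Rightarrow> 'c"
  where "quotient_part \<gamma> \<beta> a =
    (if \<exists>\<delta>\<in>carrier G. \<delta> \<otimes>\<^bsub>G\<^esub> \<beta> = \<gamma>
     then ring_sum.component (THE \<delta>. \<delta> \<in> carrier G \<and> \<delta> \<otimes>\<^bsub>G\<^esub> \<beta> = \<gamma>) a else \<zero>\<^bsub>R\<^esub>)"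

text \<open>For \<beta> in the monoid the union has at most one member, by right cancelation.
  Inserting zero gives the zero group when no quotient exists.\<close>

definition quotient_homogeneous :: "'a \<Rightarrow> 'a \<Rightarrow> 'c set"
  where "quotient_homogeneous \<gamma> \<beta> =
    insert \<zero>\<^bsub>R\<^esub> (\<Union>\<delta>\<in>{\<delta>\<in>carrier G. \<delta> \<otimes>\<^bsub>G\<^esub> \<beta> = \<gamma>}. A \<delta>)"

lemma quotient_part_eq:
  assumes "\<delta> \<in> carrier G" "\<beta> \<in> carrier G" "\<delta> \<otimes>\<^bsub>G\<^esub> \<beta> = \<gamma>"
  shows "quotient_part \<gamma> \<beta> a = ring_sum.component \<delta> a"
proof -
  have "(THE \<delta>. \<delta> \<in> carrier G \<and> \<delta> \<otimes>\<^bsub>G\<^esub> \<beta> = \<gamma>) = \<delta>"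
    using assms r_cancel by (intro the_equality) auto
  then show ?thesis using assms by (auto simp: quotient_part_def)
qed

lemma quotient_homogeneous_closed: "a \<in> quotient_homogeneous \<gamma> \<beta> \<Longrightarrow> a \<in> carrier R"
  using ring_sum.summand_closed by (auto simp: quotient_homogeneous_def)

lemma quotient_part_homogeneous:
  assumes "\<beta> \<in> carrier G" "a \<in> carrier R"
  shows "quotient_part \<gamma> \<beta> a \<in> quotient_homogeneous \<gamma> \<beta>"
proof (cases "\<exists>\<delta>\<in>carrier G. \<delta> \<otimes>\<^bsub>G\<^esub> \<beta> = \<gamma>")
  case True
  then obtain \<delta> where d: "\<delta> \<in> carrier G" "\<delta> \<otimes>\<^bsub>G\<^esub> \<beta> = \<gamma>" by auto
  then show ?thesis
    using quotient_part_eq[OF d(1) assms(1) d(2)] ring_sum.component_props(1)[OF assms(2) d(1)]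
    by (auto simp: quotient_homogeneous_def)
qed (auto simp: quotient_part_def quotient_homogeneous_def)

lemma quotient_part_closed:
  "\<lbrakk>\<beta> \<in> carrier G; a \<in> carrier R\<rbrakk> \<Longrightarrow> quotient_part \<gamma> \<beta> a \<in> carrier R"
  using quotient_part_homogeneous quotient_homogeneous_closed by blast

lemma quotient_part_add:
  assumes "\<beta> \<in> carrier G" "a \<in> carrier R" "b \<in> carrier R"
  shows "quotient_part \<gamma> \<beta> (a \<oplus>\<^bsub>R\<^esub> b) = quotient_part \<gamma> \<beta> a \<oplus>\<^bsub>R\<^esub> quotient_part \<gamma> \<beta> b"
proof (cases "\<exists>\<delta>\<in>carrier G. \<delta> \<otimes>\<^bsub>G\<^esub> \<beta> = \<gamma>")
  case True
  then show ?thesis using assms by (auto simp: quotient_part_eq ring_sum.component_add)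
qed (auto simp: quotient_part_def)

lemma quotient_part_finsum:
  assumes "\<beta> \<in> carrier G" "f \<in> F \<rightarrow> carrier R"
  shows "quotient_part \<gamma> \<beta> (\<Oplus>\<^bsub>R\<^esub>i\<in>F. f i) = (\<Oplus>\<^bsub>R\<^esub>i\<in>F. quotient_part \<gamma> \<beta> (f i))"
  using assms quotient_part_add quotient_part_closed R.is_abelian_group
  by (intro additive_map_finsum) auto

lemma quotient_part_zero: "\<beta> \<in> carrier G \<Longrightarrow> quotient_part \<gamma> \<beta> \<zero>\<^bsub>R\<^esub> = \<zero>\<^bsub>R\<^esub>"
  using quotient_part_finsum[of \<beta> undefined "{}"] by simp

lemma quotient_part_of_homogeneous:
  assumes "\<delta> \<in> carrier G" "\<beta> \<in> carrier G" "a \<in> A \<delta>"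
  shows "quotient_part \<gamma> \<beta> a = (if \<delta> \<otimes>\<^bsub>G\<^esub> \<beta> = \<gamma> then a else \<zero>\<^bsub>R\<^esub>)"
proof (cases "\<exists>\<epsilon>\<in>carrier G. \<epsilon> \<otimes>\<^bsub>G\<^esub> \<beta> = \<gamma>")
  case True
  then obtain \<epsilon> where e: "\<epsilon> \<in> carrier G" "\<epsilon> \<otimes>\<^bsub>G\<^esub> \<beta> = \<gamma>" by auto
  then have "\<epsilon> = \<delta> \<longleftrightarrow> \<delta> \<otimes>\<^bsub>G\<^esub> \<beta> = \<gamma>" using assms r_cancel by auto
  then show ?thesis
    using quotient_part_eq[OF e(1) assms(2) e(2)] ring_sum.component_homogeneous assms e by simp
qed (use assms in \<open>auto simp: quotient_part_def\<close>)

lemma quotient_part_id: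
  assumes "\<beta> \<in> carrier G" "a \<in> quotient_homogeneous \<gamma> \<beta>"
  shows "quotient_part \<gamma> \<beta> a = a"
  using assms quotient_part_of_homogeneous quotient_part_zero
  by (auto simp: quotient_homogeneous_def)

text \<open>The set is the image of the additive projection
  \<open>quotient_part \<gamma> \<beta>\<close>, which fixes it pointwise.\<close>

lemma quotient_homogeneous_add:
  assumes "\<beta> \<in> carrier G" "a \<in> quotient_homogeneous \<gamma> \<beta>" "b \<in> quotient_homogeneous \<gamma> \<beta>"
  shows "a \<oplus>\<^bsub>R\<^esub> b \<in> quotient_homogeneous \<gamma> \<beta>"
proof -
  have "quotient_part \<gamma> \<beta> (a \<oplus>\<^bsub>R\<^esub> b) = a \<oplus>\<^bsub>R\<^esub> b"
    using assms quotient_homogeneous_closed by (simp add: quotient_part_add quotient_part_id)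
  moreover have "quotient_part \<gamma> \<beta> (a \<oplus>\<^bsub>R\<^esub> b) \<in> quotient_homogeneous \<gamma> \<beta>"
    using assms quotient_homogeneous_closed by (intro quotient_part_homogeneous) auto
  ultimately show ?thesis by simp
qed

text \<open>Degrees compose: \<open>\<delta> \<kappa> = \<gamma>\<close> and
  \<open>\<epsilon> \<beta> = \<kappa>\<close> give
  \<open>(\<delta> \<epsilon>) \<beta> = \<gamma>\<close>.\<close>

lemma quotient_homogeneous_mult:
  assumes "\<beta> \<in> carrier G" "\<kappa> \<in> carrier G"
    and a: "a \<in> quotient_homogeneous \<gamma> \<kappa>" and b: "b \<in> quotient_homogeneous \<kappa> \<beta>"
  shows "a \<otimes>\<^bsub>R\<^esub> b \<in> quotient_homogeneous \<gamma> \<beta>"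
proof (cases "a = \<zero>\<^bsub>R\<^esub> \<or> b = \<zero>\<^bsub>R\<^esub>")
  case True
  then have "a \<otimes>\<^bsub>R\<^esub> b = \<zero>\<^bsub>R\<^esub>" using a b quotient_homogeneous_closed by auto
  then show ?thesis by (simp add: quotient_homogeneous_def)
next
  case False
  then obtain \<delta> \<epsilon> where "\<delta> \<in> carrier G" "\<delta> \<otimes>\<^bsub>G\<^esub> \<kappa> = \<gamma>" "a \<in> A \<delta>"
    "\<epsilon> \<in> carrier G" "\<epsilon> \<otimes>\<^bsub>G\<^esub> \<beta> = \<kappa>" "b \<in> A \<epsilon>"
    using a b unfolding quotient_homogeneous_def by auto
  moreover from this have "(\<delta> \<otimes>\<^bsub>G\<^esub> \<epsilon>) \<otimes>\<^bsub>G\<^esub> \<beta> = \<gamma>" using assms by (simp add: grading_monoid.m_assoc)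
  ultimately show ?thesis
    unfolding quotient_homogeneous_def using ring_graded_mult by blast
qed

text \<open>Right cancelation turns \<open>\<delta> \<gamma> = \<gamma>\<close> into
  \<open>\<delta> = \<one>\<close>. This places the diagonal entries of the syzygy matrix in the
  local ring.\<close>

lemma quotient_homogeneous_same:
  assumes "\<gamma> \<in> carrier G"
  shows "quotient_homogeneous \<gamma> \<gamma> = A \<one>\<^bsub>G\<^esub>"
proof -
  have "{\<delta>\<in>carrier G. \<delta> \<otimes>\<^bsub>G\<^esub> \<gamma> = \<gamma>} = {\<one>\<^bsub>G\<^esub>}"
    using assms r_cancel[of _ \<gamma> "\<one>\<^bsub>G\<^esub>"] by auto
  then show ?thesis
    using additive_subgroup.zero_closed[OF ring_sum.summand[of "\<one>\<^bsub>G\<^esub>"]]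
    by (auto simp: quotient_homogeneous_def)
qed

text \<open>Left cancelation enters here: if \<open>\<delta> \<kappa> = \<gamma>\<close>, then \<open>\<delta> \<epsilon> \<beta> = \<gamma>\<close> only if \<open>\<epsilon> \<beta> = \<kappa>\<close>.\<close>

lemma quotient_part_mult:
  assumes \<beta>: "\<beta> \<in> carrier G" and \<kappa>: "\<kappa> \<in> carrier G"
    and c: "c \<in> quotient_homogeneous \<gamma> \<kappa>" and a: "a \<in> carrier R"
  shows "quotient_part \<gamma> \<beta> (c \<otimes>\<^bsub>R\<^esub> a) = c \<otimes>\<^bsub>R\<^esub> quotient_part \<kappa> \<beta> a"
proof (cases "c = \<zero>\<^bsub>R\<^esub>")
  case True
  then show ?thesis using assms by (simp add: quotient_part_zero quotient_part_closed)
next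
  case False
  then obtain \<delta> where d: "\<delta> \<in> carrier G" "\<delta> \<otimes>\<^bsub>G\<^esub> \<kappa> = \<gamma>" "c \<in> A \<delta>"
    using c unfolding quotient_homogeneous_def by auto
  have cR: "c \<in> carrier R" using c quotient_homogeneous_closed by blast
  show ?thesis using a
  proof (induction a rule: ring_sum.homogeneous_induct)
    case zero
    then show ?case using \<beta> cR by (simp add: quotient_part_zero)
  next
    case (homogeneous \<epsilon> a)
    have "\<delta> \<otimes>\<^bsub>G\<^esub> (\<epsilon> \<otimes>\<^bsub>G\<^esub> \<beta>) = \<delta> \<otimes>\<^bsub>G\<^esub> \<kappa> \<longleftrightarrow> \<epsilon> \<otimes>\<^bsub>G\<^esub> \<beta> = \<kappa>"
      using l_cancel[of \<delta> "\<epsilon> \<otimes>\<^bsub>G\<^esub> \<beta>" \<kappa>] d homogeneous \<beta> \<kappa> by auto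
    then have "(\<delta> \<otimes>\<^bsub>G\<^esub> \<epsilon>) \<otimes>\<^bsub>G\<^esub> \<beta> = \<gamma> \<longleftrightarrow> \<epsilon> \<otimes>\<^bsub>G\<^esub> \<beta> = \<kappa>"
      using d homogeneous \<beta> by (simp add: grading_monoid.m_assoc)
    then show ?case
      using quotient_part_of_homogeneous[of "\<delta> \<otimes>\<^bsub>G\<^esub> \<epsilon>" \<beta> "c \<otimes>\<^bsub>R\<^esub> a" \<gamma>]
        quotient_part_of_homogeneous[of \<epsilon> \<beta> a \<kappa>] ring_graded_mult[of \<delta> \<epsilon> c a] d homogeneous \<beta> cR
      by auto
  next
    case (add a b)
    then show ?case
      using cR \<beta> by (simp add: R.r_distr quotient_part_add quotient_part_closed)
  qed
qed

end

section \<open>Homogeneous parts of relations\<close>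

locale cancel_graded_module = graded_module + cancel_graded_ring
begin

text \<open>For \<open>a\<close> of degree \<delta> the product has degree
  \<open>\<delta> \<beta>\<close>, so it contributes to degree \<gamma> exactly when \<delta> is the
  quotient. Additivity in \<open>a\<close> does the rest.\<close>

lemma component_smult:
  assumes "\<beta> \<in> carrier G" "\<gamma> \<in> carrier G" "x \<in> S \<beta>" "a \<in> carrier R"
  shows "module_sum.component \<gamma> (a \<odot>\<^bsub>M\<^esub> x) = quotient_part \<gamma> \<beta> a \<odot>\<^bsub>M\<^esub> x"
  using assms(4)
proof (induction a rule: ring_sum.homogeneous_induct)
  case zero
  then show ?case
    using assms module_sum.summand_closed
    by (simp add: quotient_part_zero module_sum.component_zero)
next
  case (homogeneous \<delta> a)
  then show ?case
    using quotient_part_of_homogeneous[of \<delta> \<beta> a \<gamma>] module_graded_smult[of \<delta> \<beta> a x]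
      module_sum.component_homogeneous[of "\<delta> \<otimes>\<^bsub>G\<^esub> \<beta>" "a \<odot>\<^bsub>M\<^esub> x" \<gamma>] assms
      module_sum.summand_closed
    by auto
next
  case (add a b)
  then show ?case
    using assms module_sum.summand_closed
    by (simp add: M.smult_l_distr module_sum.component_add quotient_part_add quotient_part_closed)
qed

end

lemma (in cancel_graded_module) component_combination:
  assumes X: "\<And>x. x \<in> X \<Longrightarrow> d x \<in> carrier G" "\<And>x. x \<in> X \<Longrightarrow> x \<in> S (d x)"
    and a: "a \<in> X \<rightarrow> carrier R" and \<gamma>: "\<gamma> \<in> carrier G"
  shows "module_sum.component \<gamma> (\<Oplus>\<^bsub>M\<^esub>x\<in>X. a x \<odot>\<^bsub>M\<^esub> x) =
    (\<Oplus>\<^bsub>M\<^esub>x\<in>X. quotient_part \<gamma> (d x) (a x) \<odot>\<^bsub>M\<^esub> x)"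
proof -
  have aR: "a x \<in> carrier R" and xM: "x \<in> carrier M" if "x \<in> X" for x
    using that a module_sum.summand_closed[OF X(1)[OF that] X(2)[OF that]] by auto
  then have "module_sum.component \<gamma> (\<Oplus>\<^bsub>M\<^esub>x\<in>X. a x \<odot>\<^bsub>M\<^esub> x) =
      (\<Oplus>\<^bsub>M\<^esub>x\<in>X. module_sum.component \<gamma> (a x \<odot>\<^bsub>M\<^esub> x))"
    using \<gamma> by (intro module_sum.component_finsum) auto
  also have "\<dots> = (\<Oplus>\<^bsub>M\<^esub>x\<in>X. quotient_part \<gamma> (d x) (a x) \<odot>\<^bsub>M\<^esub> x)"
    using X \<gamma> aR xM quotient_part_closed
    by (intro M.finsum_cong') (auto simp: component_smult)
  finally show ?thesis .
qed

text \<open>Taking the component of degree \<gamma> of a relation gives a relation among the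
  corresponding parts of the coefficients.\<close>

lemma (in cancel_graded_module) quotient_part_syzygy:
  assumes X: "\<And>x. x \<in> X \<Longrightarrow> d x \<in> carrier G" "\<And>x. x \<in> X \<Longrightarrow> x \<in> S (d x)"
    and a: "M.syzygy X a" and \<gamma>: "\<gamma> \<in> carrier G"
  shows "M.syzygy X (\<lambda>x. quotient_part \<gamma> (d x) (a x))"
proof -
  have aR: "a \<in> X \<rightarrow> carrier R" using a by (simp add: M.syzygy_def)
  then have "(\<lambda>x. quotient_part \<gamma> (d x) (a x)) \<in> X \<rightarrow> carrier R"
    using X(1) quotient_part_closed by (simp add: Pi_iff)
  moreover have "(\<Oplus>\<^bsub>M\<^esub>x\<in>X. quotient_part \<gamma> (d x) (a x) \<odot>\<^bsub>M\<^esub> x) = \<zero>\<^bsub>M\<^esub>"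
    using component_combination[OF X aR \<gamma>] a module_sum.component_zero[OF \<gamma>]
    by (simp add: M.syzygy_def)
  ultimately show ?thesis by (simp add: M.syzygy_def)
qed


section \<open>Graded local rings\<close>

context graded_local_ring
begin

text \<open>Updating the carrier keeps the unit of \<open>R\<close>, so the ring axioms for the
  degree-one part include this membership.\<close>

lemma one_in_degree_one: "\<one>\<^bsub>R\<^esub> \<in> A \<one>\<^bsub>G\<^esub>"
proof -
  interpret L: local_ring "R\<lparr>carrier := A \<one>\<^bsub>G\<^esub>\<rparr>" by (rule degree_one_local)
  show ?thesis using L.one_closed by simp
qed

text \<open>An element without left inverse in \<open>R\<close> has none in the degree-one part, so
  the result on local rings applies to \<open>x\<close> and \<open>1 - x\<close> there.\<close>

lemma right_inverse_of_complement:
  assumes x: "x \<in> A \<one>\<^bsub>G\<^esub>" and inv: "\<And>b. b \<in> carrier R \<Longrightarrow> b \<otimes>\<^bsub>R\<^esub> x \<noteq> \<one>\<^bsub>R\<^esub>"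
  obtains u where "u \<in> A \<one>\<^bsub>G\<^esub>" "(\<one>\<^bsub>R\<^esub> \<ominus>\<^bsub>R\<^esub> x) \<otimes>\<^bsub>R\<^esub> u = \<one>\<^bsub>R\<^esub>"
proof -
  interpret L: local_ring "R\<lparr>carrier := A \<one>\<^bsub>G\<^esub>\<rparr>" by (rule degree_one_local)
  interpret A1: additive_subgroup "A \<one>\<^bsub>G\<^esub>" R by (rule ring_sum.summand) simp
  have xR: "x \<in> carrier R" using x A1.a_subset by auto
  have "\<one>\<^bsub>R\<^esub> \<ominus>\<^bsub>R\<^esub> x \<in> A \<one>\<^bsub>G\<^esub>" using x one_in_degree_one by (simp add: a_minus_def)
  moreover have "x \<oplus>\<^bsub>R\<^esub> (\<one>\<^bsub>R\<^esub> \<ominus>\<^bsub>R\<^esub> x) = \<one>\<^bsub>R\<^esub>"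
    using xR by (simp add: a_minus_def R.a_comm[of x] R.a_assoc R.l_neg)
  moreover have "b \<otimes>\<^bsub>R\<^esub> x \<noteq> \<one>\<^bsub>R\<^esub>" if "b \<in> A \<one>\<^bsub>G\<^esub>" for b
    using that inv A1.a_subset by auto
  ultimately show thesis
    using L.right_inverse_of_complement[of x "\<one>\<^bsub>R\<^esub> \<ominus>\<^bsub>R\<^esub> x"] x that by auto
qed

end

section \<open>Elimination of homogeneous syzygies\<close>

locale cancel_graded_local_module = cancel_graded_module + graded_local_ring
begin

text \<open>Since \<open>1 - N j j\<close> is a unit, \<open>c j\<close> is a left combination of the other \<open>c k\<close>; substituting
  it keeps the rows homogeneous syzygies and removes \<open>j\<close> from the index set.\<close>

lemma eliminate_homogeneous_syzygies:
  assumes X: "finite X" "X \<subseteq> carrier M" "\<And>x. x \<in> X \<Longrightarrow> d x \<in> carrier G"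
    and non_inv: "\<And>c x b. \<lbrakk>M.syzygy X c; x \<in> X; b \<in> carrier R\<rbrakk> \<Longrightarrow> b \<otimes>\<^bsub>R\<^esub> c x \<noteq> \<one>\<^bsub>R\<^esub>"
    and c: "c \<in> X \<rightarrow> carrier R"
    and "finite J" "J \<subseteq> X"
    and "\<And>k. k \<in> J \<Longrightarrow> M.syzygy X (N k)"
    and "\<And>k i. \<lbrakk>k \<in> J; i \<in> X\<rbrakk> \<Longrightarrow> N k i \<in> quotient_homogeneous (d k) (d i)"
    and "\<And>i. i \<in> X \<Longrightarrow> c i = (\<Oplus>\<^bsub>R\<^esub>k\<in>J. c k \<otimes>\<^bsub>R\<^esub> N k i)"
    and "i \<in> X"
  shows "c i = \<zero>\<^bsub>R\<^esub>"
  using \<open>finite J\<close> assms(7-)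
\<comment> \<open>The coefficients \<open>c\<close> stay fixed while \<open>J\<close> shrinks and
  the matrix changes. When \<open>J\<close> is empty, each \<open>c i\<close> is an empty
  sum.\<close>
proof (induction J arbitrary: N i)
  case empty
  then show ?case by simp
next
  case (insert j J)
  note syz = insert.prems(2) and hom = insert.prems(3) and rep = insert.prems(4)
  have jX: "j \<in> X" and JX: "J \<subseteq> X" using insert.prems(1) by auto
  have cR: "c k \<in> carrier R" if "k \<in> X" for k using c that by auto
  have NR: "N k i \<in> carrier R" if "k \<in> insert j J" "i \<in> X" for k i
    using hom[OF that] quotient_homogeneous_closed by blast
  have "N j j \<in> A \<one>\<^bsub>G\<^esub>"
    using hom[of j j] jX X(3) quotient_homogeneous_same by auto
  \<comment> \<open>The pivot: \<open>N j j\<close> is a coefficient of a syzygy, hence not left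
    invertible.\<close>
  then obtain u where u: "u \<in> A \<one>\<^bsub>G\<^esub>" and inv: "(\<one>\<^bsub>R\<^esub> \<ominus>\<^bsub>R\<^esub> N j j) \<otimes>\<^bsub>R\<^esub> u = \<one>\<^bsub>R\<^esub>"
    using non_inv[OF syz[of j] jX] by (rule right_inverse_of_complement) auto
  have uR: "u \<in> carrier R" using u ring_sum.summand_closed[of "\<one>\<^bsub>G\<^esub>"] by simp
  \<comment> \<open>Column \<open>j\<close> times the inverse pivot: \<open>v k\<close> is the
    coefficient of \<open>c k\<close> once \<open>c j (1 - N j j)\<close> has been solved for
    \<open>c j\<close>.\<close>
  define v where "v k = N k j \<otimes>\<^bsub>R\<^esub> u" for k
  have vR: "v k \<in> carrier R" if "k \<in> J" for k using that NR jX uR by (simp add: v_def)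
  have split: "c i = c j \<otimes>\<^bsub>R\<^esub> N j i \<oplus>\<^bsub>R\<^esub> (\<Oplus>\<^bsub>R\<^esub>k\<in>J. c k \<otimes>\<^bsub>R\<^esub> N k i)" if "i \<in> X" for i
  proof -
    have "(\<lambda>k. c k \<otimes>\<^bsub>R\<^esub> N k i) \<in> J \<rightarrow> carrier R" using cR NR JX that by auto
    then show ?thesis using rep[OF that] insert.hyps cR NR jX that by simp
  qed
  have cj: "c j = (\<Oplus>\<^bsub>R\<^esub>k\<in>J. c k \<otimes>\<^bsub>R\<^esub> v k)"
  proof -
    let ?s = "\<Oplus>\<^bsub>R\<^esub>k\<in>J. c k \<otimes>\<^bsub>R\<^esub> N k j"
    have f: "(\<lambda>k. c k \<otimes>\<^bsub>R\<^esub> N k j) \<in> J \<rightarrow> carrier R" using cR NR JX jX by auto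
    then have s: "?s \<in> carrier R" by simp
    have cn: "c j \<in> carrier R" "N j j \<in> carrier R" using cR NR jX by auto
    have "c j \<otimes>\<^bsub>R\<^esub> (\<one>\<^bsub>R\<^esub> \<ominus>\<^bsub>R\<^esub> N j j) = c j \<ominus>\<^bsub>R\<^esub> c j \<otimes>\<^bsub>R\<^esub> N j j"
      using cn by (simp add: a_minus_def R.r_distr R.r_minus)
    also have "\<dots> = ?s"
      using split[OF jX] s cn
      by (metis R.a_comm R.add.m_closed R.m_closed R.minus_eq R.add.inv_solve_right)
    finally have "?s \<otimes>\<^bsub>R\<^esub> u = c j \<otimes>\<^bsub>R\<^esub> (\<one>\<^bsub>R\<^esub> \<ominus>\<^bsub>R\<^esub> N j j) \<otimes>\<^bsub>R\<^esub> u" by simp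
    also have "\<dots> = c j" using cn uR inv by (simp add: R.m_assoc)
    finally have "c j = (\<Oplus>\<^bsub>R\<^esub>k\<in>J. c k \<otimes>\<^bsub>R\<^esub> N k j \<otimes>\<^bsub>R\<^esub> u)"
      using R.finsum_ldistr[OF insert.hyps(1) uR f] by simp
    also have "\<dots> = (\<Oplus>\<^bsub>R\<^esub>k\<in>J. c k \<otimes>\<^bsub>R\<^esub> v k)"
      using cR NR JX jX uR vR by (intro R.finsum_cong') (auto simp: v_def R.m_assoc subset_iff)
    finally show ?thesis .
  qed
  \<comment> \<open>The effect of substituting \<open>c j\<close>: row \<open>k\<close> gains the
    left multiple \<open>v k\<close> of row \<open>j\<close>.\<close>
  define N' where "N' k i = N k i \<oplus>\<^bsub>R\<^esub> v k \<otimes>\<^bsub>R\<^esub> N j i" for k i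
  show ?case
  proof (rule insert.IH[of N'])
    show "J \<subseteq> X" by (rule JX)
    show "i \<in> X" by (rule insert.prems(5))
  next
    fix k i assume k: "k \<in> J" and i: "i \<in> X"
    \<comment> \<open>As \<open>u\<close> has degree one, \<open>v k\<close> keeps the degree of
      \<open>N k j\<close>, and \<open>v k\<close> times \<open>N j i\<close> has the degree
      required of entry \<open>k\<close>, \<open>i\<close>.\<close>
    have "u \<in> quotient_homogeneous (d j) (d j)"
      using u X(3) jX by (simp add: quotient_homogeneous_same)
    moreover have "N k j \<in> quotient_homogeneous (d k) (d j)" using hom k jX by auto
    ultimately have "v k \<in> quotient_homogeneous (d k) (d j)"
      unfolding v_def using X(3) jX by (intro quotient_homogeneous_mult) auto
    then have "v k \<otimes>\<^bsub>R\<^esub> N j i \<in> quotient_homogeneous (d k) (d i)"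
      using X(3) jX i hom by (intro quotient_homogeneous_mult[of _ "d j"]) auto
    then show "N' k i \<in> quotient_homogeneous (d k) (d i)"
      unfolding N'_def using X(3) i k hom by (intro quotient_homogeneous_add) auto
  next
    fix k assume k: "k \<in> J"
    have "(\<Oplus>\<^bsub>M\<^esub>i\<in>X. N' k i \<odot>\<^bsub>M\<^esub> i) =
        (\<Oplus>\<^bsub>M\<^esub>i\<in>X. N k i \<odot>\<^bsub>M\<^esub> i \<oplus>\<^bsub>M\<^esub> v k \<odot>\<^bsub>M\<^esub> (N j i \<odot>\<^bsub>M\<^esub> i))"
      using k NR vR X(2)
      by (intro M.finsum_cong') (auto simp: N'_def M.smult_l_distr M.smult_assoc1 subset_iff)
    also have "\<dots> = (\<Oplus>\<^bsub>M\<^esub>i\<in>X. N k i \<odot>\<^bsub>M\<^esub> i) \<oplus>\<^bsub>M\<^esub> (\<Oplus>\<^bsub>M\<^esub>i\<in>X. v k \<odot>\<^bsub>M\<^esub> (N j i \<odot>\<^bsub>M\<^esub> i))"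
      using k NR vR X(2) by (intro M.finsum_addf) auto
    also have "(\<Oplus>\<^bsub>M\<^esub>i\<in>X. v k \<odot>\<^bsub>M\<^esub> (N j i \<odot>\<^bsub>M\<^esub> i)) = v k \<odot>\<^bsub>M\<^esub> (\<Oplus>\<^bsub>M\<^esub>i\<in>X. N j i \<odot>\<^bsub>M\<^esub> i)"
      using k NR vR X(1,2) by (intro M.finsum_smult_ldistr[symmetric]) auto
    finally have "(\<Oplus>\<^bsub>M\<^esub>i\<in>X. N' k i \<odot>\<^bsub>M\<^esub> i) = \<zero>\<^bsub>M\<^esub>"
      using syz[of k] syz[of j] k vR by (simp add: M.syzygy_def)
    then show "M.syzygy X (N' k)"
      using k NR vR by (auto simp: M.syzygy_def N'_def)
  next
    fix i assume i: "i \<in> X"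
    have "c j \<otimes>\<^bsub>R\<^esub> N j i = (\<Oplus>\<^bsub>R\<^esub>k\<in>J. c k \<otimes>\<^bsub>R\<^esub> v k \<otimes>\<^bsub>R\<^esub> N j i)"
      unfolding cj using insert.hyps(1) NR i cR JX vR by (intro R.finsum_ldistr) auto
    then have "c i = (\<Oplus>\<^bsub>R\<^esub>k\<in>J. c k \<otimes>\<^bsub>R\<^esub> v k \<otimes>\<^bsub>R\<^esub> N j i) \<oplus>\<^bsub>R\<^esub> (\<Oplus>\<^bsub>R\<^esub>k\<in>J. c k \<otimes>\<^bsub>R\<^esub> N k i)"
      using split[OF i] by simp
    also have "\<dots> = (\<Oplus>\<^bsub>R\<^esub>k\<in>J. c k \<otimes>\<^bsub>R\<^esub> v k \<otimes>\<^bsub>R\<^esub> N j i \<oplus>\<^bsub>R\<^esub> c k \<otimes>\<^bsub>R\<^esub> N k i)"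
      using NR i cR JX vR by (intro R.finsum_addf[symmetric]) auto
    also have "\<dots> = (\<Oplus>\<^bsub>R\<^esub>k\<in>J. c k \<otimes>\<^bsub>R\<^esub> N' k i)"
      using NR i cR JX vR
      by (intro R.finsum_cong') (auto simp: N'_def R.r_distr R.m_assoc R.a_comm subset_iff)
    finally show "c i = (\<Oplus>\<^bsub>R\<^esub>k\<in>J. c k \<otimes>\<^bsub>R\<^esub> N' k i)" .
  qed
qed

text \<open>Writing \<open>E\<close> for the matrix of a section, the rows of \<open>1 - E\<close> are syzygies and \<open>c = c (1 - E)\<close>
  for every syzygy \<open>c\<close>; for homogeneous \<open>c\<close> this persists in the homogeneous parts of the rows.\<close>

lemma homogeneous_syzygy_eq_zero:
  assumes proj: "projective_module R M" and X: "finite X" "generates R M X"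
    and min: "\<And>Y. Y \<subset> X \<Longrightarrow> \<not> generates R M Y"
    and d: "\<And>x. x \<in> X \<Longrightarrow> d x \<in> carrier G" "\<And>x. x \<in> X \<Longrightarrow> x \<in> S (d x)"
    and c: "M.syzygy X c" "\<And>x. x \<in> X \<Longrightarrow> c x \<in> quotient_homogeneous \<gamma> (d x)"
    and i: "i \<in> X"
  shows "c i = \<zero>\<^bsub>R\<^esub>"
proof -
  obtain E where ER: "\<And>x y. x \<in> X \<Longrightarrow> E x y \<in> carrier R"
    and E: "\<And>x. x \<in> X \<Longrightarrow> (\<Oplus>\<^bsub>M\<^esub>y\<in>X. E x y \<odot>\<^bsub>M\<^esub> y) = x"
    and Ec: "\<And>c y. M.syzygy X c \<Longrightarrow> (\<Oplus>\<^bsub>R\<^esub>x\<in>X. c x \<otimes>\<^bsub>R\<^esub> E x y) = \<zero>\<^bsub>R\<^esub>"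
    using M.projective_coordinates[OF proj X] by blast
  have XM: "X \<subseteq> carrier M" using X by (simp add: generates_def)
  have cR: "c x \<in> carrier R" if "x \<in> X" for x using c(1) that by (auto simp: M.syzygy_def)
  define D where "D x y = (if y = x then \<one>\<^bsub>R\<^esub> else \<zero>\<^bsub>R\<^esub>) \<ominus>\<^bsub>R\<^esub> E x y" for x y
  have DR: "D x y \<in> carrier R" if "x \<in> X" for x y using ER that by (simp add: D_def)
  \<comment> \<open>Row \<open>x\<close> of \<open>D + E\<close> is the unit vector at
    \<open>x\<close>, and row \<open>x\<close> of \<open>E\<close> also represents \<open>x\<close>;
    the difference represents zero.\<close>
  have D_syz: "M.syzygy X (D x)" if x: "x \<in> X" for x
  proof -
    have "(\<Oplus>\<^bsub>M\<^esub>y\<in>X. (if y = x then y else \<zero>\<^bsub>M\<^esub>)) =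
        (\<Oplus>\<^bsub>M\<^esub>y\<in>X. D x y \<odot>\<^bsub>M\<^esub> y \<oplus>\<^bsub>M\<^esub> E x y \<odot>\<^bsub>M\<^esub> y)"
    proof (rule M.finsum_cong')
      fix y assume y: "y \<in> X"
      have "D x y \<oplus>\<^bsub>R\<^esub> E x y = (if y = x then \<one>\<^bsub>R\<^esub> else \<zero>\<^bsub>R\<^esub>)"
        using ER[OF x] by (simp add: D_def a_minus_def R.a_assoc R.l_neg)
      moreover have "D x y \<odot>\<^bsub>M\<^esub> y \<oplus>\<^bsub>M\<^esub> E x y \<odot>\<^bsub>M\<^esub> y = (D x y \<oplus>\<^bsub>R\<^esub> E x y) \<odot>\<^bsub>M\<^esub> y"
        using y XM DR ER x by (intro M.smult_l_distr[symmetric]) auto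
      ultimately show "(if y = x then y else \<zero>\<^bsub>M\<^esub>) = D x y \<odot>\<^bsub>M\<^esub> y \<oplus>\<^bsub>M\<^esub> E x y \<odot>\<^bsub>M\<^esub> y"
        using y XM by auto
    qed (use DR ER x XM in auto)
    also have "\<dots> = (\<Oplus>\<^bsub>M\<^esub>y\<in>X. D x y \<odot>\<^bsub>M\<^esub> y) \<oplus>\<^bsub>M\<^esub> (\<Oplus>\<^bsub>M\<^esub>y\<in>X. E x y \<odot>\<^bsub>M\<^esub> y)"
      using DR ER x XM by (intro M.finsum_addf) auto
    also have "(\<Oplus>\<^bsub>M\<^esub>y\<in>X. E x y \<odot>\<^bsub>M\<^esub> y) = x" by (rule E[OF x])
    also have "(\<Oplus>\<^bsub>M\<^esub>y\<in>X. (if y = x then y else \<zero>\<^bsub>M\<^esub>)) = x"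
      using XM by (intro M.add.finprod_singleton_swap[OF x X(1)]) auto
    finally have "x = (\<Oplus>\<^bsub>M\<^esub>y\<in>X. D x y \<odot>\<^bsub>M\<^esub> y) \<oplus>\<^bsub>M\<^esub> x" .
    moreover have "(\<Oplus>\<^bsub>M\<^esub>y\<in>X. D x y \<odot>\<^bsub>M\<^esub> y) \<in> carrier M"
      using DR x XM by (intro M.finsum_closed) auto
    ultimately have "(\<Oplus>\<^bsub>M\<^esub>y\<in>X. D x y \<odot>\<^bsub>M\<^esub> y) = \<zero>\<^bsub>M\<^esub>"
      using x XM M.add.r_cancel_one'[of x] by blast
    then show ?thesis using DR x by (auto simp: M.syzygy_def)
  qed
  \<comment> \<open>\<open>c (D + E) = c\<close>, while \<open>c E = 0\<close> because the section
    maps the relation to zero.\<close>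
  have cD: "c y = (\<Oplus>\<^bsub>R\<^esub>x\<in>X. c x \<otimes>\<^bsub>R\<^esub> D x y)" if y: "y \<in> X" for y
  proof -
    have "(\<Oplus>\<^bsub>R\<^esub>x\<in>X. if y = x then c x else \<zero>\<^bsub>R\<^esub>) =
        (\<Oplus>\<^bsub>R\<^esub>x\<in>X. c x \<otimes>\<^bsub>R\<^esub> D x y \<oplus>\<^bsub>R\<^esub> c x \<otimes>\<^bsub>R\<^esub> E x y)"
    proof (rule R.finsum_cong')
      fix x assume x: "x \<in> X"
      have "D x y \<oplus>\<^bsub>R\<^esub> E x y = (if y = x then \<one>\<^bsub>R\<^esub> else \<zero>\<^bsub>R\<^esub>)"
        using ER[OF x] by (simp add: D_def a_minus_def R.a_assoc R.l_neg)
      moreover have "c x \<otimes>\<^bsub>R\<^esub> D x y \<oplus>\<^bsub>R\<^esub> c x \<otimes>\<^bsub>R\<^esub> E x y = c x \<otimes>\<^bsub>R\<^esub> (D x y \<oplus>\<^bsub>R\<^esub> E x y)"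
        using DR ER x cR by (intro R.r_distr[symmetric]) auto
      ultimately show "(if y = x then c x else \<zero>\<^bsub>R\<^esub>) =
          c x \<otimes>\<^bsub>R\<^esub> D x y \<oplus>\<^bsub>R\<^esub> c x \<otimes>\<^bsub>R\<^esub> E x y"
        using x cR by auto
    qed (use DR ER cR in auto)
    also have "\<dots> = (\<Oplus>\<^bsub>R\<^esub>x\<in>X. c x \<otimes>\<^bsub>R\<^esub> D x y) \<oplus>\<^bsub>R\<^esub> (\<Oplus>\<^bsub>R\<^esub>x\<in>X. c x \<otimes>\<^bsub>R\<^esub> E x y)"
      using DR ER cR by (intro R.finsum_addf) auto
    also have "\<dots> = (\<Oplus>\<^bsub>R\<^esub>x\<in>X. c x \<otimes>\<^bsub>R\<^esub> D x y)"
      using DR cR by (simp add: Ec[OF c(1)] Pi_def)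
    finally show ?thesis
      using R.finsum_singleton[OF y X(1), of c] cR by auto
  qed
  show ?thesis
  proof (rule eliminate_homogeneous_syzygies[of X d c X "\<lambda>x y. quotient_part (d x) (d y) (D x y)"])
    show "b \<otimes>\<^bsub>R\<^esub> c' x \<noteq> \<one>\<^bsub>R\<^esub>" if "M.syzygy X c'" "x \<in> X" "b \<in> carrier R" for c' x b
      using M.syzygy_coefficient_not_invertible[OF X min that] by blast
    show "M.syzygy X (\<lambda>y. quotient_part (d x) (d y) (D x y))" if "x \<in> X" for x
      using d D_syz that by (intro quotient_part_syzygy) auto
    show "quotient_part (d x) (d y) (D x y) \<in> quotient_homogeneous (d x) (d y)"
      if "x \<in> X" "y \<in> X" for x y
      using that d DR by (intro quotient_part_homogeneous) auto
    fix y assume y: "y \<in> X"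
    \<comment> \<open>Taking this part fixes the homogeneous \<open>c y\<close>. On the right,
      \<open>quotient_part_mult\<close> pulls out \<open>c x\<close> and leaves the part of
      \<open>D x y\<close> from \<open>d y\<close> to \<open>d x\<close>.\<close>
    have "c y = quotient_part \<gamma> (d y) (\<Oplus>\<^bsub>R\<^esub>x\<in>X. c x \<otimes>\<^bsub>R\<^esub> D x y)"
      using cD[OF y] quotient_part_id[OF d(1)[OF y] c(2)[OF y]] by simp
    also have "\<dots> = (\<Oplus>\<^bsub>R\<^esub>x\<in>X. quotient_part \<gamma> (d y) (c x \<otimes>\<^bsub>R\<^esub> D x y))"
      using d y cR DR by (intro quotient_part_finsum) auto
    also have "\<dots> = (\<Oplus>\<^bsub>R\<^esub>x\<in>X. c x \<otimes>\<^bsub>R\<^esub> quotient_part (d x) (d y) (D x y))"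
      using d y cR DR c(2) quotient_part_closed
      by (intro R.finsum_cong') (auto simp: quotient_part_mult)
    finally show "c y = (\<Oplus>\<^bsub>R\<^esub>x\<in>X. c x \<otimes>\<^bsub>R\<^esub> quotient_part (d x) (d y) (D x y))" .
  qed (use X XM d cR i in auto)
qed

text \<open>A finite generating subset of \<open>X\<close> cannot be proper, so \<open>X\<close> is
  finite. For freeness, each component of each coefficient of a relation occurs in a homogeneous
  syzygy and therefore vanishes.\<close>

lemma minimal_generating_set_free:
  assumes proj: "projective_module R M" and fg: "finitely_generated R M"
    and X: "minimal_homogeneous_generating_set G R M S X"
  shows "finite X" "free_basis R M X"
proof -
  have gen: "generates R M X" and min: "\<And>Y. Y \<subset> X \<Longrightarrow> \<not> generates R M Y"
    and hom: "X \<subseteq> homogeneous_elements G M S"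
    using X by (auto simp: minimal_homogeneous_generating_set_def)
  show fin: "finite X"
    using M.finite_generating_subset[OF fg gen] min by (metis psubsetI)
  have XM: "X \<subseteq> carrier M" using gen by (simp add: generates_def)
  have "\<forall>x\<in>X. \<exists>\<gamma>. \<gamma> \<in> carrier G \<and> x \<in> S \<gamma>"
    using hom by (auto simp: homogeneous_elements_def)
  from bchoice[OF this] obtain d
    where d: "\<And>x. x \<in> X \<Longrightarrow> d x \<in> carrier G" "\<And>x. x \<in> X \<Longrightarrow> x \<in> S (d x)" by blast
  have zero: "a x = \<zero>\<^bsub>R\<^esub>" if a: "M.syzygy X a" and x: "x \<in> X" for a x
  proof -
    have aR: "a y \<in> carrier R" if "y \<in> X" for y using a that by (auto simp: M.syzygy_def)
    have "ring_sum.component \<delta> (a x) = \<zero>\<^bsub>R\<^esub>" if \<delta>: "\<delta> \<in> carrier G" for \<delta>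
    proof -
      \<comment> \<open>With this degree, the part of \<open>a x\<close> is exactly its component of
        degree \<delta>.\<close>
      let ?\<gamma> = "\<delta> \<otimes>\<^bsub>G\<^esub> d x"
      have "M.syzygy X (\<lambda>y. quotient_part ?\<gamma> (d y) (a y))"
        using d a \<delta> x by (intro quotient_part_syzygy) auto
      then have "quotient_part ?\<gamma> (d x) (a x) = \<zero>\<^bsub>R\<^esub>"
        using d aR quotient_part_homogeneous x
        by (intro homogeneous_syzygy_eq_zero[OF proj fin gen min d,
              where c = "\<lambda>y. quotient_part ?\<gamma> (d y) (a y)" and \<gamma> = ?\<gamma>]) auto
      then show ?thesis using quotient_part_eq[of \<delta> "d x"] \<delta> d x by simp
    qed
    then show ?thesis
      using ring_sum.sum_components[of "a x" "{}"] aR[OF x] by auto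
  qed
  have "linearly_independent R M X"
    unfolding linearly_independent_def
  proof (intro conjI allI impI XM ballI)
    fix F c x
    assume F: "finite F \<and> F \<subseteq> X \<and> c \<in> F \<rightarrow> carrier R \<and> (\<Oplus>\<^bsub>M\<^esub>x\<in>F. c x \<odot>\<^bsub>M\<^esub> x) = \<zero>\<^bsub>M\<^esub>" and x: "x \<in> F"
    \<comment> \<open>Extension by zero turns a relation on \<open>F\<close> into a syzygy on all of
      \<open>X\<close>.\<close>
    let ?c = "\<lambda>y. if y \<in> F then c y else \<zero>\<^bsub>R\<^esub>"
    have "(\<Oplus>\<^bsub>M\<^esub>y\<in>F. c y \<odot>\<^bsub>M\<^esub> y) = (\<Oplus>\<^bsub>M\<^esub>y\<in>X. ?c y \<odot>\<^bsub>M\<^esub> y)"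
      using F fin subsetD[OF XM]
      by (intro M.add.finprod_mono_neutral_cong_left) (auto simp: Pi_iff)
    then have "M.syzygy X ?c" using F by (auto simp: M.syzygy_def)
    then show "c x = \<zero>\<^bsub>R\<^esub>" using zero[of ?c x] x F by auto
  qed
  then show "free_basis R M X" using gen by (simp add: free_basis_def)
qed

end

text \<open>The components of finitely many generators form a finite homogeneous generating set, and
  a finite set has an inclusion-minimal generating subset.\<close>

lemma (in graded_module) ex_minimal_homogeneous_generating_set:
  assumes "finitely_generated R M"
  shows "\<exists>X. minimal_homogeneous_generating_set G R M S X"
proof -
  obtain T where T: "finite T" "generates R M T"
    using assms by (auto simp: finitely_generated_def)
  have TM: "T \<subseteq> carrier M" using T by (simp add: generates_def)
  \<comment> \<open>Only nonzero components are kept, since homogeneous elements are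
    nonzero.\<close>
  define U where
    "U = (\<Union>t\<in>T. (\<lambda>\<gamma>. module_sum.component \<gamma> t) ` {\<gamma>\<in>carrier G. module_sum.component \<gamma> t \<noteq> \<zero>\<^bsub>M\<^esub>})"
  have U: "U \<subseteq> homogeneous_elements G M S"
    using module_sum.component_props(1) TM by (auto simp: U_def homogeneous_elements_def)
  have fin: "finite U" using T(1) module_sum.component_props(2) TM by (auto simp: U_def)
  have gen: "generates R M U"
  proof (rule M.generates_trans[OF T(2)])
    show "U \<subseteq> carrier M" using module_sum.component_closed TM by (auto simp: U_def)
    fix H assume H: "submodule H R M" "U \<subseteq> H"
    show "T \<subseteq> H"
    proof
      fix t assume t: "t \<in> T"
      have "(\<Oplus>\<^bsub>M\<^esub>\<gamma>\<in>{\<gamma>\<in>carrier G. module_sum.component \<gamma> t \<noteq> \<zero>\<^bsub>M\<^esub>}. module_sum.component \<gamma> t) \<in> H"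
        using H t by (intro M.submodule_finsum) (auto simp: U_def)
      then show "t \<in> H" using module_sum.component_props(3)[of t] t TM by auto
    qed
  qed
  define \<P> where "\<P> = {X. X \<subseteq> U \<and> generates R M X}"
  have "finite \<P>" "\<P> \<noteq> {}" using fin gen by (auto simp: \<P>_def)
  then obtain X where X: "X \<in> \<P>" and min: "\<And>Y. \<lbrakk>Y \<in> \<P>; Y \<subseteq> X\<rbrakk> \<Longrightarrow> X = Y"
    using finite_has_minimal[of \<P>] by blast
  then have "minimal_homogeneous_generating_set G R M S X"
    using U unfolding minimal_homogeneous_generating_set_def \<P>_def by blast
  then show ?thesis ..
qed

theorem theorem4p6:
  fixes G :: "('g, 'b) monoid_scheme"
    and R :: "('a, 'c) ring_scheme"
    and A :: "'g \<Rightarrow> 'a set"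
    and P :: "('a, 'p, 'd) module_scheme"
    and S :: "'g \<Rightarrow> 'p set"
  assumes "monoid_cancel G"
    and "graded_local_ring G R A"
    and "gr_projective_module G R A P S"
    and "finitely_generated R P"
  shows "free_module R P \<and>
    (\<forall>\<Omega>. minimal_homogeneous_generating_set G R P S \<Omega> \<longrightarrow> finite \<Omega> \<and> free_basis R P \<Omega>)"
proof -
  interpret gr_projective_module G R A P S by fact
  interpret monoid_cancel G by fact
  interpret graded_local_ring G R A by fact
  interpret cancel_graded_local_module G R A P S by unfold_locales
  \<comment> \<open>A minimal homogeneous generating set exists, and it is the basis that witnesses
    freeness.\<close>
  show ?thesis
    using minimal_generating_set_free[OF projective assms(4)]
      ex_minimal_homogeneous_generating_set[OF assms(4)] M.left_module_axioms
    unfolding free_module_def by blast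
qed

end
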